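(* Let $\mathcal{B}_1,\mathcal{B}_3\in\{\mathbf{I}_d,\frac{\partial}{\partial\nu}\}$. For $k>0$, let $\{\tilde\mu_n\}_{n\in\mathbb{N}_0}$ be chosen according to the four-case rule in the context, let $\{\tilde X_n\}_{n\in\mathbb{N}_0}$ be an associated system of eigenfunctions (either of the two choices in the context), and let $$\tilde u=\sum_{n=0}^\infty\widehat g_1(n)\,\tilde X_n(x)\,\tilde Y_n(y)\quad\text{with}\quad\widehat g_1(n):=\int_{\Gamma_1}g_1(x)\tilde X_n(x)\,dx,$$ where $\tilde Y_n$ is the solution of $$\tilde Y_n''(y)+(k^2-\tilde\mu_n^2)\tilde Y_n(y)=0\ \text{ in }(0,1),\qquad\mathcal{B}_1\tilde Y_n(0)=1,\quad\mathcal{B}_3\tilde Y_n(1)=0,$$ be the auxiliary function satisfying $\Delta\tilde u+k^2\tilde u=0$ in $\Omega=(0,1)^2$, $\mathcal{B}_1\tilde u=g_1$ on $\Gamma_1$ and $\mathcal{B}_3\tilde u=0$ on $\Gamma_3$. Then: (1) For $\mathcal{B}_1=\frac{\partial}{\partial\nu}$, $\mathcal{B}_3\in\{\mathbf{I}_d,\frac{\partial}{\partial\nu}\}$ and $g_1\in L^2(\Gamma_1)$, the function $\tilde u$ satisfies $$\|\nabla\tilde u\|_{0,\Omega}+k\|\tilde u\|_{0,\Omega}\le2\sqrt{717}\,\max\{k,1\}\,\|g_1\|_{0,\Gamma_1},\qquad\forall\,k>0.$$ (2) For $\mathcal{B}_1=\mathbf{I}_d$, $\mathcal{B}_3\in\{\mathbf{I}_d,\frac{\partial}{\partial\nu}\}$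 and $g_1\in\mathcal{Z}^{\frac12}(\Gamma_1)$, the function $\tilde u$ satisfies $$\|\nabla\tilde u\|_{0,\Omega}+k\|\tilde u\|_{0,\Omega}\le2\sqrt{43}\left(\max\{k^2,1\}\,\|g_1\|_{0,\Gamma_1}+\max\{k^{\frac12},1\}\,\|g_1\|_{\mathcal{Z}^{\frac12}(\Gamma_1)}\right),\qquad\forall\,k>0.$$
   Context: $\Omega:=(0,1)^2$, $\Gamma_1:=(0,1)\times\{0\}$, $\Gamma_3:=(0,1)\times\{1\}$, $\mathbb{N}_0=\{0,1,2,\dots\}$; $\|\cdot\|_{0,\Omega}$, $\|\cdot\|_{0,\Gamma_1}$ are the $L^2$ norms. $\mathbf{I}_du=u$ (Dirichlet), and $\frac{\partial}{\partial\nu}$ is the outward normal derivative (Neumann), so for functions of $y$ on $(0,1)$, $\frac{\partial}{\partial\nu}\tilde Y(0)=-\tilde Y'(0)$ and $\frac{\partial}{\partial\nu}\tilde Y(1)=\tilde Y'(1)$. $\mathcal{B}_1=\mathcal{B}_3$ means that both are $\mathbf{I}_d$ or both are $\frac{\partial}{\partial\nu}$. Choice of $\tilde\mu_n$: let $d_0:=\inf_{n\in\mathbb{Z}}|k^2-n\pi^2|\in[0,\frac12\pi^2]$. For all $n\in\mathbb{N}_0$, $$\tilde\mu_n=\begin{cases}(n+\frac12)\pi,&\text{if }\mathcal{B}_1=\mathcal{B}_3\text{ and }d_0\in[0,\frac18\pi^2],\\ n\pi,&\text{if }\mathcal{B}_1=\mathcal{B}_3\text{ and }d_0\notin[0,\frac18\pi^2],\\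 n\pi,&\text{if }\mathcal{B}_1\ne\mathcal{B}_3\text{ and }d_0\in[0,\frac18\pi^2]\cup[\frac38\pi^2,\frac12\pi^2],\\ (n+\frac12)\pi,&\text{if }\mathcal{B}_1\ne\mathcal{B}_3\text{ and }d_0\notin[0,\frac18\pi^2]\cup[\frac38\pi^2,\frac12\pi^2].\end{cases}$$ (With these choices each boundary value problem for $\tilde Y_n$ has a unique solution.) Choice of $\tilde X_n$: if $\tilde\mu_n=n\pi$, then either $\tilde X_0=0$, $\tilde X_n(x)=\sqrt2\sin(n\pi x)$ ($n\ge1$), or $\tilde X_0=1$, $\tilde X_n(x)=\sqrt2\cos(n\pi x)$ ($n\ge1$). If $\tilde\mu_n=(n+\frac12)\pi$, then either $\tilde X_n(x)=\sqrt2\sin((n+\frac12)\pi x)$ for all $n\ge0$, or $\tilde X_n(x)=\sqrt2\cos((n+\frac12)\pi x)$ for all $n\ge0$. For $s\ge0$, $g\in\mathcal{Z}^s(\Gamma_1)$ means $g\in L^2(\Gamma_1)$ and $\|g\|_{\mathcal{Z}^s(\Gamma_1)}^2:=\sum_{n=0}^\infty|\widehat g(n)|^2\tilde\mu_n^{2s}<\infty$, where $\widehat g(n)=\int_0^1g(x)\tilde X_n(x)\,dx$ (with the chosen pairs $(\tilde\mu_n,\tilde X_n)$). The series defining $\tilde u$ is understood in $L^2(\Omega)$ and $\nabla\tilde u$ is the weak gradient. *)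

theory Defs
  imports "HOL-Analysis.Analysis"
begin

text \<open>Square-integrable functions are represented by (Lebesgue measurable) functions, not by
  classes modulo null sets; two representatives of the same class have the same norm.\<close>

definition L2_on :: "'a::euclidean_space set \<Rightarrow> ('a \<Rightarrow> 'b::{real_normed_vector,second_countable_topology}) \<Rightarrow> bool" where
  "L2_on S f \<longleftrightarrow> f \<in> borel_measurable (lebesgue_on S) \<and> integrable (lebesgue_on S) (\<lambda>z. (norm (f z))\<^sup>2)"

definition L2_norm :: "'a::euclidean_space set \<Rightarrow> ('a \<Rightarrow> 'b::real_normed_vector) \<Rightarrow> real" where
  "L2_norm S f = sqrt (LINT z|lebesgue_on S. (norm (f z))\<^sup>2)"

definition L2_sums :: "'a::euclidean_space set \<Rightarrow> (nat \<Rightarrow> 'a \<Rightarrow> complex) \<Rightarrow> ('a \<Rightarrow> complex) \<Rightarrow> bool" where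
  "L2_sums S f u \<longleftrightarrow> (\<forall>n. L2_on S (f n)) \<and> L2_on S u \<and>
     (\<lambda>N. L2_norm S (\<lambda>z. u z - (\<Sum>n<N. f n z))) \<longlonglongrightarrow> 0"

definition Omega :: "(real \<times> real) set" where
  "Omega = {0<..<1} \<times> {0<..<1}"

text \<open>The edge \<open>(0,1) \<times> {0}\<close> of \<open>Omega\<close> is parametrised by its first coordinate, so that arc
  length becomes Lebesgue measure on \<open>(0,1)\<close>.\<close>

definition Gamma1 :: "real set" where
  "Gamma1 = {0<..<1}"

text \<open>Smooth functions on the plane with compact support inside \<open>S\<close>; \<open>D i j\<close> is the partial
  derivative of order \<open>i\<close> in the first and \<open>j\<close> in the second variable.\<close>

definition smooth_plane :: "(real \<times> real \<Rightarrow> real) \<Rightarrow> bool" where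
  "smooth_plane \<phi> \<longleftrightarrow> (\<exists>D :: nat \<Rightarrow> nat \<Rightarrow> real \<times> real \<Rightarrow> real. D 0 0 = \<phi> \<and>
     (\<forall>i j. continuous_on UNIV (D i j) \<and>
       (\<forall>x y. ((\<lambda>t. D i j (t, y)) has_real_derivative D (Suc i) j (x, y)) (at x)) \<and>
       (\<forall>x y. ((\<lambda>t. D i j (x, t)) has_real_derivative D i (Suc j) (x, y)) (at y))))"

definition test_function :: "(real \<times> real) set \<Rightarrow> (real \<times> real \<Rightarrow> real) \<Rightarrow> bool" where
  "test_function S \<phi> \<longleftrightarrow> smooth_plane \<phi> \<and> (\<exists>K. compact K \<and> K \<subseteq> S \<and> (\<forall>z. z \<notin> K \<longrightarrow> \<phi> z = 0))"

definition d_x :: "(real \<times> real \<Rightarrow> real) \<Rightarrow> real \<times> real \<Rightarrow> real" where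
  "d_x \<phi> z = deriv (\<lambda>t. \<phi> (t, snd z)) (fst z)"

definition d_y :: "(real \<times> real \<Rightarrow> real) \<Rightarrow> real \<times> real \<Rightarrow> real" where
  "d_y \<phi> z = deriv (\<lambda>t. \<phi> (fst z, t)) (snd z)"

text \<open>The norm of a pair is Euclidean, so \<open>(L2_norm S G)\<^sup>2\<close> is the sum of the squared norms of the
  two components.  Real test functions suffice for complex-valued \<open>u\<close> by linearity.\<close>

definition weak_gradient :: "(real \<times> real) set \<Rightarrow> (real \<times> real \<Rightarrow> complex) \<Rightarrow> (real \<times> real \<Rightarrow> complex \<times> complex) \<Rightarrow> bool" where
  "weak_gradient S u G \<longleftrightarrow> L2_on S u \<and> L2_on S G \<and>
     (\<forall>\<phi>. test_function S \<phi> \<longrightarrow>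
        (LINT z|lebesgue_on S. u z * of_real (d_x \<phi> z)) = - (LINT z|lebesgue_on S. fst (G z) * of_real (\<phi> z)) \<and>
        (LINT z|lebesgue_on S. u z * of_real (d_y \<phi> z)) = - (LINT z|lebesgue_on S. snd (G z) * of_real (\<phi> z)))"

datatype bc = Dirichlet | Neumann

text \<open>Value at the end point \<open>y\<close> of the boundary operator applied to \<open>Y\<close> with derivative \<open>Y'\<close>,
  where \<open>\<nu>\<close> is the outward normal there: \<open>-1\<close> at \<open>y = 0\<close> and \<open>1\<close> at \<open>y = 1\<close>.\<close>

fun bdry_op :: "bc \<Rightarrow> real \<Rightarrow> (real \<Rightarrow> real) \<Rightarrow> (real \<Rightarrow> real) \<Rightarrow> real \<Rightarrow> real" where
  "bdry_op Dirichlet \<nu> Y Y' y = Y y"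
| "bdry_op Neumann \<nu> Y Y' y = \<nu> * Y' y"

definition is_Y_solution :: "bc \<Rightarrow> bc \<Rightarrow> real \<Rightarrow> real \<Rightarrow> (real \<Rightarrow> real) \<Rightarrow> bool" where
  "is_Y_solution B1 B3 k \<mu> Y \<longleftrightarrow> (\<exists>Y' Y''.
     (\<forall>y\<in>{0..1}. (Y has_real_derivative Y' y) (at y within {0..1})) \<and>
     (\<forall>y\<in>{0<..<1}. (Y' has_real_derivative Y'' y) (at y) \<and> Y'' y + (k\<^sup>2 - \<mu>\<^sup>2) * Y y = 0) \<and>
     bdry_op B1 (-1) Y Y' 0 = 1 \<and> bdry_op B3 1 Y Y' 1 = 0)"

definition d0 :: "real \<Rightarrow> real" where
  "d0 k = (INF n::int. \<bar>k\<^sup>2 - of_int n * pi\<^sup>2\<bar>)"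

definition mu :: "bc \<Rightarrow> bc \<Rightarrow> real \<Rightarrow> nat \<Rightarrow> real" where
  "mu B1 B3 k n =
     (if B1 = B3 then
        (if d0 k \<in> {0..pi\<^sup>2 / 8} then (real n + 1/2) * pi else real n * pi)
      else
        (if d0 k \<in> {0..pi\<^sup>2 / 8} \<union> {3 * pi\<^sup>2 / 8..pi\<^sup>2 / 2} then real n * pi else (real n + 1/2) * pi))"

definition eigen_system :: "(nat \<Rightarrow> real) \<Rightarrow> (nat \<Rightarrow> real \<Rightarrow> real) \<Rightarrow> bool" where
  "eigen_system \<mu> X \<longleftrightarrow>
     \<mu> = (\<lambda>n. real n * pi) \<and>
       (X = (\<lambda>n x. if n = 0 then 0 else sqrt 2 * sin (real n * pi * x)) \<or>
        X = (\<lambda>n x. if n = 0 then 1 else sqrt 2 * cos (real n * pi * x))) \<or>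
     \<mu> = (\<lambda>n. (real n + 1/2) * pi) \<and>
       (X = (\<lambda>n x. sqrt 2 * sin ((real n + 1/2) * pi * x)) \<or>
        X = (\<lambda>n x. sqrt 2 * cos ((real n + 1/2) * pi * x)))"

definition ghat :: "(nat \<Rightarrow> real \<Rightarrow> real) \<Rightarrow> (real \<Rightarrow> complex) \<Rightarrow> nat \<Rightarrow> complex" where
  "ghat X g n = (LINT x|lebesgue_on Gamma1. g x * of_real (X n x))"

text \<open>The weight is \<open>\<mu> n powr (2 * s)\<close>, except that \<open>0 powr 0 = 0\<close> in the library, whereas
  \<open>0\<close> to the power \<open>0\<close> counts as \<open>1\<close> here.\<close>

definition Z_weight :: "real \<Rightarrow> real \<Rightarrow> real" where
  "Z_weight s m = (if s = 0 then 1 else m powr (2 * s))"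

definition Z_space :: "(nat \<Rightarrow> real) \<Rightarrow> (nat \<Rightarrow> real \<Rightarrow> real) \<Rightarrow> real \<Rightarrow> (real \<Rightarrow> complex) \<Rightarrow> bool" where
  "Z_space \<mu> X s g \<longleftrightarrow> L2_on Gamma1 g \<and> summable (\<lambda>n. (cmod (ghat X g n))\<^sup>2 * Z_weight s (\<mu> n))"

definition Z_norm :: "(nat \<Rightarrow> real) \<Rightarrow> (nat \<Rightarrow> real \<Rightarrow> real) \<Rightarrow> real \<Rightarrow> (real \<Rightarrow> complex) \<Rightarrow> real" where
  "Z_norm \<mu> X s g = sqrt (\<Sum>n. (cmod (ghat X g n))\<^sup>2 * Z_weight s (\<mu> n))"

definition u_term :: "(nat \<Rightarrow> real \<Rightarrow> real) \<Rightarrow> (nat \<Rightarrow> real \<Rightarrow> real) \<Rightarrow> (real \<Rightarrow> complex) \<Rightarrow> nat \<Rightarrow> real \<times> real \<Rightarrow> complex" where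
  "u_term X Y g n z = ghat X g n * of_real (X n (fst z)) * of_real (Y n (snd z))"

end

theory Submission
  imports Defs
begin

text \<open>The functions \<open>X n\<close>, and likewise their derivatives, are pairwise orthogonal, so the squared norms
  of \<open>u\<close> and \<open>\<nabla>u\<close> are sums over \<open>n\<close>, and Bessel's inequality reduces the theorem to bounds for each
  \<open>Y n\<close>, in terms of \<open>\<kappa>\<^sup>2 = \<bar>k\<^sup>2 - \<mu>\<^sup>2\<bar>\<close>.  The choice of \<open>\<mu>\<close> keeps \<open>k\<^sup>2 - \<mu>\<^sup>2\<close> at distance at least
  \<open>\<pi>\<^sup>2/8\<close> from the eigenvalues of the problem in \<open>y\<close>, so for \<open>\<mu> \<le> k\<close> the denominator
  \<open>sin \<kappa>\<close> or \<open>cos \<kappa>\<close> of \<open>Y n\<close> is at least of order \<open>1/\<kappa>\<close>.  For \<open>\<mu> > k\<close> the solutions are hyperbolic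
  and bounded; in the Dirichlet case the energy identity costs a factor \<open>\<mu>\<close>, which is where the
  weight of \<open>Z\<^sup>1\<^sup>/\<^sup>2\<close> enters.\<close>

subsection \<open>Square-integrable functions\<close>

text \<open>The rule for \<mu> rests on arithmetic modulo one. The squares of \<mu> and of an
  eigenvalue parameter m pi or (m + 1/2) pi in y add up to pi^2 times an integer plus r, with r = 0,
  1/4 or 1/2, and each case of the rule selects an r at distance at least 1/8 from k^2 / pi^2 modulo
  one. The given \<open>Y n\<close> obeys the equation only inside (0, 1) and has one-sided
  derivatives at the ends. It is replaced by an explicit solution on the whole line, so that the
  partial sums are smooth on the plane and their classical gradients are weak gradients; the
  orthogonal series of gradients converges as well, and \<open>u\<close> inherits its weak gradient
  as a limit. Pointwise estimates of \<open>Y n\<close> and its derivative suffice except in the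
  hyperbolic Dirichlet case. There the derivative is of size \<kappa> at y = 0 for large \<kappa>,
  which would cost \<mu>^2 when squared; it decays over a length of order 1 / \<kappa>, and only an
  integrated estimate sees this gain. The gradient and k \<open>u\<close> are bounded by the same
  square root, whence the factor 2. The numbers 717 and 43 under the roots majorize the bounds for
  single modes, which come from (14/3)^2 = 196/9.\<close>

lemma L2_on_norm_mult_integrable:
  fixes f :: "'a::euclidean_space \<Rightarrow> 'b::euclidean_space" and g :: "'a \<Rightarrow> 'c::euclidean_space"
  assumes "L2_on S f" "L2_on S g"
  shows "integrable (lebesgue_on S) (\<lambda>z. norm (f z) * norm (g z))"
proof (rule Bochner_Integration.integrable_bound)
  show "integrable (lebesgue_on S) (\<lambda>z. (norm (f z))\<^sup>2 + (norm (g z))\<^sup>2)"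
    using assms by (auto simp: L2_on_def)
  have [measurable]: "f \<in> borel_measurable (lebesgue_on S)" "g \<in> borel_measurable (lebesgue_on S)"
    using assms by (auto simp: L2_on_def)
  show "(\<lambda>z. norm (f z) * norm (g z)) \<in> borel_measurable (lebesgue_on S)"
    by measurable
  have "norm (norm a * norm b) \<le> norm ((norm a)\<^sup>2 + (norm b)\<^sup>2)" for a :: 'b and b :: 'c
  proof -
    have "0 \<le> norm a * norm b" by simp
    then show ?thesis
      using sum_squares_bound[of "norm a" "norm b"] by (simp, linarith)
  qed
  then show "AE z in lebesgue_on S. norm (norm (f z) * norm (g z)) \<le> norm ((norm (f z))\<^sup>2 + (norm (g z))\<^sup>2)"
    by simp
qed

lemma L2_on_inner_integrable:
  fixes f g :: "'a::euclidean_space \<Rightarrow> 'b::euclidean_space"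
  assumes "L2_on S f" "L2_on S g"
  shows "integrable (lebesgue_on S) (\<lambda>z. f z \<bullet> g z)"
proof (rule Bochner_Integration.integrable_bound[OF L2_on_norm_mult_integrable[OF assms]])
  have [measurable]: "f \<in> borel_measurable (lebesgue_on S)" "g \<in> borel_measurable (lebesgue_on S)"
    using assms by (auto simp: L2_on_def)
  show "(\<lambda>z. f z \<bullet> g z) \<in> borel_measurable (lebesgue_on S)"
    by measurable
qed (auto simp: Cauchy_Schwarz_ineq2)

lemma L2_on_imp_integrable:
  fixes f :: "'a::euclidean_space \<Rightarrow> 'b::euclidean_space"
  assumes "S \<in> lmeasurable" "L2_on S f"
  shows "integrable (lebesgue_on S) f"
proof (rule Bochner_Integration.integrable_bound)
  interpret finite_measure "lebesgue_on S"
    using assms(1) by (rule finite_measure_lebesgue_on)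
  show "integrable (lebesgue_on S) (\<lambda>z. 1 + (norm (f z))\<^sup>2)"
    using assms by (auto simp: L2_on_def)
  have "x \<le> 1 + x\<^sup>2" for x :: real
    using sum_squares_bound[of x 1] by (smt (verit) one_power2 zero_le_power2)
  then show "AE z in lebesgue_on S. norm (f z) \<le> norm (1 + (norm (f z))\<^sup>2)"
    by (smt (verit) AE_I2 real_norm_def)
qed (use assms in \<open>auto simp: L2_on_def\<close>)

lemma L2_on_add:
  fixes f g :: "'a::euclidean_space \<Rightarrow> 'b::euclidean_space"
  assumes "L2_on S f" "L2_on S g"
  shows "L2_on S (\<lambda>z. f z + g z)"
proof -
  have "(norm (f z + g z))\<^sup>2 = (norm (f z))\<^sup>2 + 2 * (f z \<bullet> g z) + (norm (g z))\<^sup>2" for z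
    by (simp add: power2_norm_eq_inner inner_simps inner_commute)
  then show ?thesis
    using assms L2_on_inner_integrable[OF assms] by (auto simp: L2_on_def)
qed

lemma L2_on_scaleR:
  fixes f :: "'a::euclidean_space \<Rightarrow> 'b::euclidean_space"
  assumes "L2_on S f"
  shows "L2_on S (\<lambda>z. c *\<^sub>R f z)"
  using assms by (auto simp: L2_on_def power_mult_distrib)

lemma L2_on_diff:
  fixes f g :: "'a::euclidean_space \<Rightarrow> 'b::euclidean_space"
  assumes "L2_on S f" "L2_on S g"
  shows "L2_on S (\<lambda>z. f z - g z)"
  using L2_on_add[OF assms(1) L2_on_scaleR[OF assms(2), of "-1"]] by simp

lemma L2_on_sum:
  fixes f :: "'i \<Rightarrow> 'a::euclidean_space \<Rightarrow> 'b::euclidean_space"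
  assumes "\<And>i. i \<in> I \<Longrightarrow> L2_on S (f i)"
  shows "L2_on S (\<lambda>z. \<Sum>i\<in>I. f i z)"
  using assms
proof (induction I rule: infinite_finite_induct)
  case (insert i I)
  then show ?case by (auto intro!: L2_on_add)
qed (auto simp: L2_on_def)

lemma L2_norm_nonneg: "0 \<le> L2_norm S f"
  by (simp add: L2_norm_def)

lemma L2_norm_power2: "(L2_norm S f)\<^sup>2 = (LINT z|lebesgue_on S. (norm (f z))\<^sup>2)"
  by (simp add: L2_norm_def)

lemma L2_on_cong:
  assumes "\<And>z. z \<in> S \<Longrightarrow> f z = g z"
  shows "L2_on S f \<longleftrightarrow> L2_on S g"
  unfolding L2_on_def
  using assms by (intro conj_cong measurable_cong Bochner_Integration.integrable_cong) auto

lemma L2_norm_cong: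
  assumes "\<And>z. z \<in> S \<Longrightarrow> f z = g z"
  shows "L2_norm S f = L2_norm S g"
  unfolding L2_norm_def
  using assms by (intro arg_cong[where f=sqrt] Bochner_Integration.integral_cong) auto

lemma L2_norm_minus_commute:
  "L2_norm S (\<lambda>z. f z - g z) = L2_norm S (\<lambda>z. g z - f z)"
  by (simp add: L2_norm_def norm_minus_commute)

section \<open>Cauchy-Schwarz and triangle inequality\<close>

text \<open>The integral of (s |f| - t |g|)^2 is nonnegative for all real s and t; inserting the
  norms of g and f for s and t and dividing gives the claim. The integrand is a product of norms, so
  f and g may take values in different spaces, as with a complex function against a real test
  function.\<close>

lemma L2_Cauchy_Schwarz:
  fixes f :: "'a::euclidean_space \<Rightarrow> 'b::euclidean_space" and g :: "'a \<Rightarrow> 'c::euclidean_space"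
  assumes "L2_on S f" "L2_on S g"
  shows "(LINT z|lebesgue_on S. norm (f z) * norm (g z)) \<le> L2_norm S f * L2_norm S g"
proof -
  let ?B = "LINT z|lebesgue_on S. norm (f z) * norm (g z)"
  let ?A = "L2_norm S f" and ?C = "L2_norm S g"
  have *: "2 * s * t * ?B \<le> s\<^sup>2 * ?A\<^sup>2 + t\<^sup>2 * ?C\<^sup>2" for s t :: real
  proof -
    have "0 \<le> (LINT z|lebesgue_on S. (s * norm (f z) - t * norm (g z))\<^sup>2)"
      by simp
    also have "\<dots> = (LINT z|lebesgue_on S. s\<^sup>2 * (norm (f z))\<^sup>2 + t\<^sup>2 * (norm (g z))\<^sup>2 - 2 * s * t * (norm (f z) * norm (g z)))"
      by (simp add: power2_eq_square algebra_simps)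
    also have "\<dots> = s\<^sup>2 * ?A\<^sup>2 + t\<^sup>2 * ?C\<^sup>2 - 2 * s * t * ?B"
      using L2_on_norm_mult_integrable[OF assms] assms by (simp add: L2_norm_power2 L2_on_def)
    finally show ?thesis by simp
  qed
  have "?B \<ge> 0" by simp
  show ?thesis
  proof (cases "?A = 0 \<or> ?C = 0")
    case True
    have "?B \<le> 0"
    proof (rule ccontr)
      assume "\<not> ?B \<le> 0"
      then have B: "?B > 0" by simp
      show False
      proof (cases "?A = 0")
        case A: True
        \<comment> \<open>With vanishing norm of f the quadratic inequality says 2 s
          \<open>?B\<close> \<le> \<open>?C\<close>^2 for every s, which this s violates.\<close>
        define s where "s = (?C\<^sup>2 + 1) / (2 * ?B)"
        have "2 * s * ?B = ?C\<^sup>2 + 1" using B by (simp add: s_def)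
        then show False using *[of s 1] A by simp
      next
        case False
        define t where "t = (?A\<^sup>2 + 1) / (2 * ?B)"
        have "2 * t * ?B = ?A\<^sup>2 + 1" using B by (simp add: t_def)
        then show False using *[of 1 t] False True by simp
      qed
    qed
    then show ?thesis
      using L2_norm_nonneg[of S f] L2_norm_nonneg[of S g] by (smt (verit) mult_nonneg_nonneg)
  next
    case False
    then have pos: "?A > 0" "?C > 0"
      using L2_norm_nonneg[of S f] L2_norm_nonneg[of S g] by auto
    have "(2 * ?A * ?C) * ?B \<le> (2 * ?A * ?C) * (?A * ?C)"
      using *[of ?C ?A] by (simp add: power2_eq_square algebra_simps)
    then show ?thesis
      using pos by (subst (asm) mult_le_cancel_left_pos) auto
  qed
qed

lemma L2_Cauchy_Schwarz_mult:
  fixes f :: "'a::euclidean_space \<Rightarrow> complex" and \<psi> :: "'a \<Rightarrow> real"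
  assumes "L2_on S f" "L2_on S \<psi>"
  shows "integrable (lebesgue_on S) (\<lambda>z. f z * of_real (\<psi> z))"
    and "cmod (LINT z|lebesgue_on S. f z * of_real (\<psi> z)) \<le> L2_norm S f * L2_norm S \<psi>"
proof -
  have [measurable]: "f \<in> borel_measurable (lebesgue_on S)" "\<psi> \<in> borel_measurable (lebesgue_on S)"
    using assms by (auto simp: L2_on_def)
  show "integrable (lebesgue_on S) (\<lambda>z. f z * of_real (\<psi> z))"
    by (rule Bochner_Integration.integrable_bound[OF L2_on_norm_mult_integrable[OF assms]]) (auto simp: norm_mult)
  have "cmod (LINT z|lebesgue_on S. f z * of_real (\<psi> z)) \<le> (LINT z|lebesgue_on S. norm (f z * of_real (\<psi> z)))"
    by (rule integral_norm_bound)
  also have "\<dots> = (LINT z|lebesgue_on S. norm (f z) * norm (\<psi> z))"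
    by (simp add: norm_mult)
  also have "\<dots> \<le> L2_norm S f * L2_norm S \<psi>"
    by (rule L2_Cauchy_Schwarz[OF assms])
  finally show "cmod (LINT z|lebesgue_on S. f z * of_real (\<psi> z)) \<le> L2_norm S f * L2_norm S \<psi>" .
qed

lemma L2_norm_triangle:
  fixes f g :: "'a::euclidean_space \<Rightarrow> 'b::euclidean_space"
  assumes "L2_on S f" "L2_on S g"
  shows "L2_norm S (\<lambda>z. f z + g z) \<le> L2_norm S f + L2_norm S g"
proof (rule power2_le_imp_le)
  have "(L2_norm S (\<lambda>z. f z + g z))\<^sup>2 \<le>
      (LINT z|lebesgue_on S. (norm (f z))\<^sup>2 + 2 * (norm (f z) * norm (g z)) + (norm (g z))\<^sup>2)"
    unfolding L2_norm_power2
  proof (rule integral_mono)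
    show "(norm (f z + g z))\<^sup>2 \<le> (norm (f z))\<^sup>2 + 2 * (norm (f z) * norm (g z)) + (norm (g z))\<^sup>2" for z
      using power_mono[OF norm_triangle_ineq[of "f z" "g z"], of 2] by (simp add: power2_sum)
  qed (use assms L2_on_add[OF assms] L2_on_norm_mult_integrable[OF assms] in \<open>auto simp: L2_on_def\<close>)
  also have "\<dots> = (L2_norm S f)\<^sup>2 + 2 * (LINT z|lebesgue_on S. norm (f z) * norm (g z)) + (L2_norm S g)\<^sup>2"
    using assms L2_on_norm_mult_integrable[OF assms] by (simp add: L2_norm_power2 L2_on_def)
  also have "\<dots> \<le> (L2_norm S f + L2_norm S g)\<^sup>2"
    using L2_Cauchy_Schwarz[OF assms] by (simp add: power2_sum)
  finally show "(L2_norm S (\<lambda>z. f z + g z))\<^sup>2 \<le> (L2_norm S f + L2_norm S g)\<^sup>2" .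
qed (simp add: L2_norm_nonneg)

section \<open>Fatou bound and completeness\<close>

text \<open>Integrability of the limit is part of the conclusion, so Fatou's lemma is applied to
  extended nonnegative integrals of |f n|^2, and the result is read back as a norm
  afterwards.\<close>

lemma L2_fatou:
  fixes f :: "nat \<Rightarrow> 'a::euclidean_space \<Rightarrow> 'b::euclidean_space"
  assumes f: "\<And>n. L2_on S (f n)" and [measurable]: "u \<in> borel_measurable (lebesgue_on S)"
    and lim: "AE z in lebesgue_on S. (\<lambda>n. f n z) \<longlonglongrightarrow> u z"
    and le: "eventually (\<lambda>n. L2_norm S (f n) \<le> e) sequentially" and "0 \<le> e"
  shows "L2_on S u" "L2_norm S u \<le> e"
proof -
  let ?M = "lebesgue_on S"
  have [measurable]: "f n \<in> borel_measurable ?M" for n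
    using f by (auto simp: L2_on_def)
  have "(\<integral>\<^sup>+z. ennreal ((norm (u z))\<^sup>2) \<partial>?M) = (\<integral>\<^sup>+z. liminf (\<lambda>n. ennreal ((norm (f n z))\<^sup>2)) \<partial>?M)"
  proof (rule nn_integral_cong_AE)
    show "AE z in ?M. ennreal ((norm (u z))\<^sup>2) = liminf (\<lambda>n. ennreal ((norm (f n z))\<^sup>2))"
      using lim
    proof eventually_elim
      case (elim z)
      then have "(\<lambda>n. ennreal ((norm (f n z))\<^sup>2)) \<longlonglongrightarrow> ennreal ((norm (u z))\<^sup>2)"
        by (intro tendsto_ennrealI tendsto_intros)
      then show ?case
        by (intro lim_imp_Liminf[symmetric]) auto
    qed
  qed
  also have "\<dots> \<le> liminf (\<lambda>n. \<integral>\<^sup>+z. ennreal ((norm (f n z))\<^sup>2) \<partial>?M)"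
    by (rule nn_integral_liminf) measurable
  also have "\<dots> = liminf (\<lambda>n. ennreal ((L2_norm S (f n))\<^sup>2))"
    using f by (simp add: nn_integral_eq_integral L2_norm_power2 L2_on_def)
  also have "\<dots> \<le> liminf (\<lambda>n. ennreal (e\<^sup>2))"
    by (intro Liminf_mono eventually_mono[OF le] ennreal_leI power_mono L2_norm_nonneg)
  also have "\<dots> = ennreal (e\<^sup>2)"
    by (simp add: Liminf_const)
  finally have *: "(\<integral>\<^sup>+z. ennreal ((norm (u z))\<^sup>2) \<partial>?M) \<le> ennreal (e\<^sup>2)" .
  have "integrable ?M (\<lambda>z. (norm (u z))\<^sup>2)"
    by (rule integrableI_bounded) (use * in \<open>auto intro: le_less_trans\<close>)
  then show "L2_on S u" by (simp add: L2_on_def)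
  then have "(\<integral>\<^sup>+z. ennreal ((norm (u z))\<^sup>2) \<partial>?M) = ennreal ((L2_norm S u)\<^sup>2)"
    by (subst nn_integral_eq_integral) (auto simp: L2_norm_power2 L2_on_def)
  with * have "(L2_norm S u)\<^sup>2 \<le> e\<^sup>2" by simp
  then show "L2_norm S u \<le> e"
    using \<open>0 \<le> e\<close> by (rule power2_le_imp_le)
qed

text \<open>On a set of finite measure, Cauchy-Schwarz against the constant 1 makes an L2 Cauchy
  sequence Cauchy in L1, hence a subsequence converges almost everywhere. Its limit is the
  candidate, and \<open>L2_fatou\<close> lifts the convergence back to L2.\<close>

lemma L2_complete:
  fixes s :: "nat \<Rightarrow> 'a::euclidean_space \<Rightarrow> 'b::euclidean_space"
  assumes S: "S \<in> lmeasurable" and s: "\<And>n. L2_on S (s n)"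
    and cauchy: "\<And>e. e > 0 \<Longrightarrow> \<exists>N. \<forall>m\<ge>N. \<forall>n\<ge>N. L2_norm S (\<lambda>z. s m z - s n z) \<le> e"
  obtains u where "L2_on S u" "(\<lambda>n. L2_norm S (\<lambda>z. u z - s n z)) \<longlonglongrightarrow> 0"
proof -
  let ?M = "lebesgue_on S"
  interpret finite_measure ?M
    using S by (rule finite_measure_lebesgue_on)
  have [measurable]: "s n \<in> borel_measurable ?M" for n
    using s by (auto simp: L2_on_def)
  have one: "L2_on S (\<lambda>_. 1::real)"
    by (simp add: L2_on_def)
  have L1: "(LINT z|?M. norm (s m z - s n z)) \<le> L2_norm S (\<lambda>z. s m z - s n z) * L2_norm S (\<lambda>_. 1::real)" for m n
    using L2_Cauchy_Schwarz[OF L2_on_diff[OF s s] one] by simp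
  have "\<exists>N. \<forall>i\<ge>N. \<forall>j\<ge>N. (LINT z|?M. norm (s i z - s j z)) < e" if "e > 0" for e
  proof -
    \<comment> \<open>The 1 in the denominator keeps it positive when the set is null.\<close>
    define d where "d = e / (2 * (1 + L2_norm S (\<lambda>_. 1::real)))"
    have "d > 0" using that L2_norm_nonneg[of S "\<lambda>_. 1::real"] by (simp add: d_def)
    then obtain N where N: "\<And>m n. m \<ge> N \<Longrightarrow> n \<ge> N \<Longrightarrow> L2_norm S (\<lambda>z. s m z - s n z) \<le> d"
      using cauchy by blast
    have "(LINT z|?M. norm (s i z - s j z)) < e" if "i \<ge> N" "j \<ge> N" for i j
    proof -
      have "(LINT z|?M. norm (s i z - s j z)) \<le> d * L2_norm S (\<lambda>_. 1::real)"
        using L1[of i j] mult_right_mono[OF N[OF that] L2_norm_nonneg[of S "\<lambda>_. 1::real"]] by linarith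
      also have "\<dots> \<le> d * (1 + L2_norm S (\<lambda>_. 1::real))"
        using \<open>d > 0\<close> by simp
      also have "\<dots> = e / 2"
        using L2_norm_nonneg[of S "\<lambda>_. 1::real"] by (simp add: d_def field_simps)
      also have "\<dots> < e" using \<open>e > 0\<close> by simp
      finally show ?thesis .
    qed
    then show ?thesis by blast
  qed
  then obtain r where r: "strict_mono r" "AE z in ?M. Cauchy (\<lambda>i. s (r i) z)"
    by (rule cauchy_L1_AE_cauchy_subseq[OF L2_on_imp_integrable[OF S s]])
  define u where "u z = lim (\<lambda>i. s (r i) z)" for z
  have [measurable]: "u \<in> borel_measurable ?M"
    unfolding u_def by measurable
  have lim: "AE z in ?M. (\<lambda>i. s (r i) z) \<longlonglongrightarrow> u z"
    using r(2) by eventually_elim (simp add: u_def Cauchy_convergent_iff convergent_LIMSEQ_iff)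
  \<comment> \<open>Fatou in i with n fixed: the bound for \<open>s (r i) - s n\<close>, valid once
    \<open>r i\<close> \<ge> N, passes to \<open>u - s n\<close>. This yields both membership of u
    in L2 and convergence of the whole sequence.\<close>
  have main: "L2_on S (\<lambda>z. u z - s n z) \<and> L2_norm S (\<lambda>z. u z - s n z) \<le> e"
    if "e \<ge> 0" "n \<ge> N" "\<And>m n. m \<ge> N \<Longrightarrow> n \<ge> N \<Longrightarrow> L2_norm S (\<lambda>z. s m z - s n z) \<le> e" for e n N
  proof -
    have a: "\<And>i. L2_on S (\<lambda>z. s (r i) z - s n z)"
      by (intro L2_on_diff s)
    have b: "(\<lambda>z. u z - s n z) \<in> borel_measurable ?M" by measurable
    have c: "AE z in ?M. (\<lambda>i. s (r i) z - s n z) \<longlonglongrightarrow> u z - s n z"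
      using lim by eventually_elim (intro tendsto_intros)
    have d: "eventually (\<lambda>i. L2_norm S (\<lambda>z. s (r i) z - s n z) \<le> e) sequentially"
      using eventually_ge_at_top[of N]
      by eventually_elim (use that seq_suble[OF r(1)] order_trans in blast)
    show ?thesis
      using L2_fatou[OF a b c d that(1)] by auto
  qed
  obtain N0 where N0: "\<And>m n. m \<ge> N0 \<Longrightarrow> n \<ge> N0 \<Longrightarrow> L2_norm S (\<lambda>z. s m z - s n z) \<le> 1"
    using cauchy[of 1] by auto
  have "L2_on S (\<lambda>z. u z - s N0 z)"
    using main[of 1 N0 N0] N0 by auto
  from L2_on_add[OF this s[of N0]] have "L2_on S u" by simp
  moreover have "(\<lambda>n. L2_norm S (\<lambda>z. u z - s n z)) \<longlonglongrightarrow> 0"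
  proof (rule LIMSEQ_I)
    fix e :: real assume "e > 0"
    then obtain N where N: "\<And>m n. m \<ge> N \<Longrightarrow> n \<ge> N \<Longrightarrow> L2_norm S (\<lambda>z. s m z - s n z) \<le> e / 2"
      using cauchy[of "e/2"] by auto
    have "norm (L2_norm S (\<lambda>z. u z - s n z) - 0) < e" if "n \<ge> N" for n
    proof -
      have "L2_norm S (\<lambda>z. u z - s n z) \<le> e / 2"
        using main[OF _ that N] \<open>e > 0\<close> by auto
      then show ?thesis
        using \<open>e > 0\<close> L2_norm_nonneg[of S "\<lambda>z. u z - s n z"] by simp
    qed
    then show "\<exists>no. \<forall>n\<ge>no. norm (L2_norm S (\<lambda>z. u z - s n z) - 0) < e" by blast
  qed
  ultimately show ?thesis by (rule that)
qed

lemma L2_norm_le_of_limit: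
  fixes s :: "nat \<Rightarrow> 'a::euclidean_space \<Rightarrow> 'b::euclidean_space"
  assumes u: "L2_on S u" and s: "\<And>n. L2_on S (s n)"
    and lim: "(\<lambda>n. L2_norm S (\<lambda>z. u z - s n z)) \<longlonglongrightarrow> 0" and le: "\<And>n. L2_norm S (s n) \<le> c"
  shows "L2_norm S u \<le> c"
proof (rule LIMSEQ_le_const)
  show "(\<lambda>n. L2_norm S (\<lambda>z. u z - s n z) + c) \<longlonglongrightarrow> c"
    using tendsto_add[OF lim tendsto_const[of c]] by simp
  have "L2_norm S u \<le> L2_norm S (\<lambda>z. u z - s n z) + c" for n
    using L2_norm_triangle[OF L2_on_diff[OF u s[of n]] s[of n]] le[of n] by simp
  then show "\<exists>N. \<forall>n\<ge>N. L2_norm S u \<le> L2_norm S (\<lambda>z. u z - s n z) + c" by blast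
qed

section \<open>Orthogonal series and Bessel's inequality\<close>

text \<open>Pythagoras. For complex values \<open>\<bullet>\<close> is the real part of the
  Hermitian product, which is all that the squared norm of a sum involves.\<close>

lemma L2_norm_sum_orthogonal:
  fixes f :: "nat \<Rightarrow> 'a::euclidean_space \<Rightarrow> 'b::euclidean_space"
  assumes f: "\<And>n. L2_on S (f n)" and "finite I"
    and orth: "\<And>m n. m \<noteq> n \<Longrightarrow> (LINT z|lebesgue_on S. f m z \<bullet> f n z) = 0"
  shows "(L2_norm S (\<lambda>z. \<Sum>n\<in>I. f n z))\<^sup>2 = (\<Sum>n\<in>I. (L2_norm S (f n))\<^sup>2)"
proof -
  have "(L2_norm S (\<lambda>z. \<Sum>n\<in>I. f n z))\<^sup>2 = (LINT z|lebesgue_on S. (\<Sum>m\<in>I. \<Sum>n\<in>I. f m z \<bullet> f n z))"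
    unfolding L2_norm_power2 power2_norm_eq_inner inner_sum_left inner_sum_right by (subst sum.swap) (rule refl)
  also have "\<dots> = (\<Sum>m\<in>I. \<Sum>n\<in>I. (LINT z|lebesgue_on S. f m z \<bullet> f n z))"
    using f by (simp add: L2_on_inner_integrable)
  also have "\<dots> = (\<Sum>m\<in>I. \<Sum>n\<in>I. if m = n then (L2_norm S (f n))\<^sup>2 else 0)"
    by (intro sum.cong refl) (auto simp: orth L2_norm_power2 power2_norm_eq_inner)
  also have "\<dots> = (\<Sum>n\<in>I. (L2_norm S (f n))\<^sup>2)"
    using \<open>finite I\<close> by simp
  finally show ?thesis .
qed

text \<open>By Pythagoras the squared norm of a block of terms is at most the same block of
  \<open>c\<close>, so the partial sums are Cauchy. The majorant \<open>c\<close> stands in for the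
  squared norms because only estimates are at hand for the modes.\<close>

lemma L2_orthogonal_series:
  fixes f :: "nat \<Rightarrow> 'a::euclidean_space \<Rightarrow> 'b::euclidean_space"
  assumes S: "S \<in> lmeasurable" and f: "\<And>n. L2_on S (f n)"
    and orth: "\<And>m n. m \<noteq> n \<Longrightarrow> (LINT z|lebesgue_on S. f m z \<bullet> f n z) = 0"
    and le: "\<And>n. (L2_norm S (f n))\<^sup>2 \<le> c n" and c: "summable c"
  shows "\<exists>u. L2_on S u \<and> (\<lambda>N. L2_norm S (\<lambda>z. u z - (\<Sum>n<N. f n z))) \<longlonglongrightarrow> 0"
    and "L2_norm S (\<lambda>z. \<Sum>n<N. f n z) \<le> sqrt (suminf c)"
proof -
  have c0: "0 \<le> c n" for n
    using le[of n] by (smt (verit) zero_le_power2)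
  have "\<exists>N. \<forall>m\<ge>N. \<forall>n\<ge>N. L2_norm S (\<lambda>z. (\<Sum>i<m. f i z) - (\<Sum>i<n. f i z)) \<le> e" if "e > 0" for e
  proof -
    obtain N where N: "\<And>m n. m \<ge> N \<Longrightarrow> norm (sum c {m..<n}) < e\<^sup>2"
      using c \<open>e > 0\<close> unfolding summable_Cauchy by (meson zero_less_power)
    have *: "L2_norm S (\<lambda>z. (\<Sum>i<m. f i z) - (\<Sum>i<n. f i z)) \<le> e" if "n \<ge> N" "n \<le> m" for m n
    proof (rule power2_le_imp_le)
      have "(L2_norm S (\<lambda>z. (\<Sum>i<m. f i z) - (\<Sum>i<n. f i z)))\<^sup>2 = (L2_norm S (\<lambda>z. \<Sum>i\<in>{n..<m}. f i z))\<^sup>2"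
        using \<open>n \<le> m\<close> by (simp add: sum_diff_nat_ivl lessThan_atLeast0)
      also have "\<dots> = (\<Sum>i\<in>{n..<m}. (L2_norm S (f i))\<^sup>2)"
        by (rule L2_norm_sum_orthogonal[OF f _ orth]) auto
      also have "\<dots> \<le> sum c {n..<m}"
        by (intro sum_mono le)
      also have "\<dots> \<le> e\<^sup>2"
        using N[OF that(1), of m] by simp
      finally show "(L2_norm S (\<lambda>z. (\<Sum>i<m. f i z) - (\<Sum>i<n. f i z)))\<^sup>2 \<le> e\<^sup>2" .
    qed (use \<open>e > 0\<close> in simp)
    have "L2_norm S (\<lambda>z. (\<Sum>i<m. f i z) - (\<Sum>i<n. f i z)) \<le> e" if "m \<ge> N" "n \<ge> N" for m n
      using *[of n m] *[of m n] that L2_norm_minus_commute[of S "\<lambda>z. \<Sum>i<m. f i z" "\<lambda>z. \<Sum>i<n. f i z"]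
      by (cases "n \<le> m") auto
    then show ?thesis by blast
  qed
  then obtain u where "L2_on S u" "(\<lambda>N. L2_norm S (\<lambda>z. u z - (\<Sum>n<N. f n z))) \<longlonglongrightarrow> 0"
    using L2_complete[where s = "\<lambda>N z. \<Sum>n<N. f n z", OF S L2_on_sum[OF f]] by blast
  then show "\<exists>u. L2_on S u \<and> (\<lambda>N. L2_norm S (\<lambda>z. u z - (\<Sum>n<N. f n z))) \<longlonglongrightarrow> 0"
    by blast
  have "(L2_norm S (\<lambda>z. \<Sum>n<N. f n z))\<^sup>2 = (\<Sum>n<N. (L2_norm S (f n))\<^sup>2)"
    by (rule L2_norm_sum_orthogonal[OF f _ orth]) auto
  also have "\<dots> \<le> (\<Sum>n<N. c n)"
    by (intro sum_mono le)
  also have "\<dots> \<le> suminf c"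
    using c c0 by (intro sum_le_suminf) auto
  finally show "L2_norm S (\<lambda>z. \<Sum>n<N. f n z) \<le> sqrt (suminf c)"
    by (rule real_le_rsqrt)
qed

lemma Bessel_inequality:
  fixes g :: "real \<Rightarrow> complex" and X :: "nat \<Rightarrow> real \<Rightarrow> real"
  assumes g: "L2_on Gamma1 g" and X: "\<And>n. L2_on Gamma1 (X n)"
    and orth: "\<And>m n. m \<noteq> n \<Longrightarrow> (LINT x|lebesgue_on Gamma1. X m x * X n x) = 0"
    and le: "\<And>n. (LINT x|lebesgue_on Gamma1. (X n x)\<^sup>2) \<le> 1"
  shows "summable (\<lambda>n. (cmod (ghat X g n))\<^sup>2)"
    and "(\<Sum>n. (cmod (ghat X g n))\<^sup>2) \<le> (L2_norm Gamma1 g)\<^sup>2"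
proof -
  let ?M = "lebesgue_on Gamma1" and ?h = "ghat X g"
  have X': "L2_on Gamma1 (\<lambda>x. X n x *\<^sub>R ?h n)" for n
    using X[of n] by (auto simp: L2_on_def power_mult_distrib)
  have partial: "(\<Sum>n<N. (cmod (?h n))\<^sup>2) \<le> (L2_norm Gamma1 g)\<^sup>2" for N
  proof -
    define s where "s x = (\<Sum>n<N. X n x *\<^sub>R ?h n)" for x
    have s: "L2_on Gamma1 s"
      unfolding s_def by (intro L2_on_sum X')
    have "(LINT x|?M. g x \<bullet> (X n x *\<^sub>R ?h n)) = (cmod (?h n))\<^sup>2" for n
    proof -
      have "(LINT x|?M. g x \<bullet> (X n x *\<^sub>R ?h n)) = (LINT x|?M. (g x * of_real (X n x)) \<bullet> ?h n)"
        by (simp add: inner_complex_def algebra_simps)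
      also have "\<dots> = ?h n \<bullet> ?h n"
        unfolding ghat_def using L2_Cauchy_Schwarz_mult(1)[OF g X] by (intro integral_inner_left) auto
      finally show ?thesis by (simp add: power2_norm_eq_inner)
    qed
    then have gs: "(LINT x|?M. g x \<bullet> s x) = (\<Sum>n<N. (cmod (?h n))\<^sup>2)"
      unfolding s_def inner_sum_right
      by (subst Bochner_Integration.integral_sum) (use L2_on_inner_integrable[OF g X'] in auto)
    have "(L2_norm Gamma1 s)\<^sup>2 = (\<Sum>n<N. (L2_norm Gamma1 (\<lambda>x. X n x *\<^sub>R ?h n))\<^sup>2)"
      unfolding s_def
    proof (rule L2_norm_sum_orthogonal[OF X'])
      fix m n :: nat assume "m \<noteq> n"
      have "(LINT x|?M. (X m x *\<^sub>R ?h m) \<bullet> (X n x *\<^sub>R ?h n)) = (LINT x|?M. (X m x * X n x) * (?h m \<bullet> ?h n))"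
        by (simp add: mult_ac)
      also have "\<dots> = 0"
        using orth[OF \<open>m \<noteq> n\<close>] by (subst integral_mult_left_zero) simp
      finally show "(LINT x|?M. (X m x *\<^sub>R ?h m) \<bullet> (X n x *\<^sub>R ?h n)) = 0" .
    qed auto
    also have "\<dots> = (\<Sum>n<N. (LINT x|?M. (X n x)\<^sup>2) * (cmod (?h n))\<^sup>2)"
      by (simp add: L2_norm_power2 power_mult_distrib)
    also have "\<dots> \<le> (\<Sum>n<N. (cmod (?h n))\<^sup>2)"
      using le by (intro sum_mono mult_left_le_one_le) auto
    finally have ss: "(L2_norm Gamma1 s)\<^sup>2 \<le> (\<Sum>n<N. (cmod (?h n))\<^sup>2)" .
    have "0 \<le> (LINT x|?M. (norm (g x - s x))\<^sup>2)" by simp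
    also have "\<dots> = (LINT x|?M. (norm (g x))\<^sup>2 + (norm (s x))\<^sup>2 - 2 * (g x \<bullet> s x))"
      by (simp add: power2_norm_eq_inner inner_simps inner_commute algebra_simps)
    also have "\<dots> = (L2_norm Gamma1 g)\<^sup>2 + (L2_norm Gamma1 s)\<^sup>2 - 2 * (LINT x|?M. g x \<bullet> s x)"
      using g s L2_on_inner_integrable[OF g s] by (simp add: L2_norm_power2 L2_on_def)
    finally show ?thesis using gs ss by linarith
  qed
  show "summable (\<lambda>n. (cmod (?h n))\<^sup>2)"
    using partial[of "Suc _"] by (intro bounded_imp_summable[of _ "(L2_norm Gamma1 g)\<^sup>2"]) (auto simp: lessThan_Suc_atMost)
  then show "(\<Sum>n. (cmod (?h n))\<^sup>2) \<le> (L2_norm Gamma1 g)\<^sup>2"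
    by (rule suminf_le_const) (rule partial)
qed

subsection \<open>Weak gradients of separated series\<close>

text \<open>Continuity on the closed box gives integrability, and the boundary is a null set. This
  carries Lebesgue integrals over \<open>Omega\<close> and \<open>Gamma1\<close> to gauge integrals,
  where the fundamental theorem of calculus and iterated integration apply.\<close>

lemma
  fixes F :: "'a::euclidean_space \<Rightarrow> 'b::euclidean_space"
  assumes "continuous_on (cbox a b) F"
  shows integrable_box_continuous: "integrable (lebesgue_on (box a b)) F"
    and integral_box_continuous: "(LINT z|lebesgue_on (box a b). F z) = integral (cbox a b) F"
proof -
  have "set_integrable lebesgue (cbox a b) F"
    using continuous_imp_integrable[OF assms] by (simp add: set_integrable_def integrable_restrict_space)
  then have "set_integrable lebesgue (box a b) F"
    by (rule set_integrable_subset) (auto simp: box_subset_cbox)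
  then show i: "integrable (lebesgue_on (box a b)) F"
    by (simp add: set_integrable_def integrable_restrict_space)
  then show "(LINT z|lebesgue_on (box a b). F z) = integral (cbox a b) F"
    by (simp add: lebesgue_integral_eq_integral integral_open_interval)
qed

lemma L2_on_box_continuous:
  fixes F :: "'a::euclidean_space \<Rightarrow> 'b::euclidean_space"
  assumes "continuous_on (cbox a b) F"
  shows "L2_on (box a b) F"
  using integrable_box_continuous[OF assms] assms
  by (auto simp: L2_on_def intro!: integrable_box_continuous continuous_intros)

lemma Omega_eq_box: "Omega = box (0, 0) (1, 1)"
  by (auto simp: Omega_def box_def Basis_prod_def)

lemma Gamma1_eq_box: "Gamma1 = box 0 1"
  by (auto simp: Gamma1_def)

lemma L2_on_Omega_continuous:
  fixes F :: "real \<times> real \<Rightarrow> 'b::euclidean_space"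
  shows "continuous_on UNIV F \<Longrightarrow> L2_on Omega F"
  unfolding Omega_eq_box by (rule L2_on_box_continuous) (rule continuous_on_subset, auto)

lemma
  fixes F :: "real \<times> real \<Rightarrow> 'b::euclidean_space"
  assumes "continuous_on UNIV F"
  shows integrable_Omega_continuous: "integrable (lebesgue_on Omega) F"
    and integral_Omega_continuous:
      "(LINT z|lebesgue_on Omega. F z) = integral {0..1} (\<lambda>x. integral {0..1} (\<lambda>y. F (x, y)))"
    and integral_Omega_continuous':
      "(LINT z|lebesgue_on Omega. F z) = integral {0..1} (\<lambda>y. integral {0..1} (\<lambda>x. F (x, y)))"
proof -
  have c: "continuous_on S F" for S
    using assms by (rule continuous_on_subset) auto
  show "integrable (lebesgue_on Omega) F"
    unfolding Omega_eq_box by (rule integrable_box_continuous[OF c])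
  show 1: "(LINT z|lebesgue_on Omega. F z) = integral {0..1} (\<lambda>x. integral {0..1} (\<lambda>y. F (x, y)))"
    unfolding Omega_eq_box integral_box_continuous[OF c]
    using integral_prod_continuous[OF c, of 0 0 1 1] by (simp add: cbox_interval)
  show "(LINT z|lebesgue_on Omega. F z) = integral {0..1} (\<lambda>y. integral {0..1} (\<lambda>x. F (x, y)))"
    unfolding 1 using integral_swap_continuous[of 0 0 1 1 "\<lambda>x y. F (x, y)"] c
    by (simp add: cbox_interval)
qed

lemma integral_Omega_product:
  fixes p q :: "real \<Rightarrow> real"
  assumes "continuous_on UNIV p" "continuous_on UNIV q"
  shows "(LINT z|lebesgue_on Omega. p (fst z) * q (snd z)) = integral {0..1} p * integral {0..1} q"
proof -
  have "continuous_on UNIV (\<lambda>z::real\<times>real. p (fst z) * q (snd z))"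
    by (intro continuous_intros continuous_on_compose2[OF assms(1)] continuous_on_compose2[OF assms(2)]) auto
  then show ?thesis
    by (simp add: integral_Omega_continuous)
qed

lemma integral_derivative_unit_interval:
  fixes h :: "real \<Rightarrow> 'b::banach"
  assumes "\<And>t. (h has_vector_derivative h' t) (at t)"
  shows "integral {0..1} h' = h 1 - h 0"
  by (rule integral_unique, rule fundamental_theorem_of_calculus)
    (auto intro: has_vector_derivative_at_within assms)

section \<open>Weak gradients of smooth functions and of L2 limits\<close>

text \<open>Integration by parts on each horizontal and each vertical segment of the square, with
  the order of iterated integration chosen so that the differentiated variable is innermost.\<close>

lemma weak_gradient_C1:
  fixes w wx wy :: "real \<times> real \<Rightarrow> complex"
  assumes cont: "continuous_on UNIV w" "continuous_on UNIV wx" "continuous_on UNIV wy"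
    and wx: "\<And>x y. ((\<lambda>t. w (t, y)) has_vector_derivative wx (x, y)) (at x)"
    and wy: "\<And>x y. ((\<lambda>t. w (x, t)) has_vector_derivative wy (x, y)) (at y)"
  shows "weak_gradient Omega w (\<lambda>z. (wx z, wy z))"
  unfolding weak_gradient_def
proof (intro conjI allI impI)
  show "L2_on Omega w" "L2_on Omega (\<lambda>z. (wx z, wy z))"
    using cont by (auto intro!: L2_on_Omega_continuous continuous_intros)
  fix \<phi> assume "test_function Omega \<phi>"
  then obtain D K where D0: "D 0 0 = \<phi>"
    and Dc: "\<And>i j. continuous_on UNIV (D i j)"
    and Dx: "\<And>i j x y. ((\<lambda>t. D i j (t, y)) has_real_derivative D (Suc i) j (x, y)) (at x)"
    and Dy: "\<And>i j x y. ((\<lambda>t. D i j (x, t)) has_real_derivative D i (Suc j) (x, y)) (at y)"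
    and K: "K \<subseteq> Omega" "\<And>z. z \<notin> K \<Longrightarrow> \<phi> z = 0"
    unfolding test_function_def smooth_plane_def by blast
  have dx: "d_x \<phi> = D 1 0"
    using DERIV_imp_deriv[OF Dx[of 0 0]] by (auto simp: d_x_def fun_eq_iff D0)
  have dy: "d_y \<phi> = D 0 1"
    using DERIV_imp_deriv[OF Dy[of 0 0]] by (auto simp: d_y_def fun_eq_iff D0)
  \<comment> \<open>The edges lie outside the open square and hence outside \<open>K\<close>, so all
    boundary terms vanish.\<close>
  have zero: "\<phi> (0, y) = 0" "\<phi> (1, y) = 0" "\<phi> (y, 0) = 0" "\<phi> (y, 1) = 0" for y
    using K(1) by (auto simp: Omega_def intro!: K(2))
  have c\<phi>: "continuous_on UNIV \<phi>" using Dc[of 0 0] D0 by simp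
  note c = cont c\<phi> Dc
  have int: "integrable (lebesgue_on Omega) (\<lambda>z. f z * of_real (g z))"
    if "continuous_on UNIV f" "continuous_on UNIV g" for f :: "real \<times> real \<Rightarrow> complex" and g
    using that by (intro integrable_Omega_continuous continuous_intros)
  have "(LINT z|lebesgue_on Omega. w z * of_real (D 1 0 z) + wx z * of_real (\<phi> z)) = 0"
  proof -
    have "integral {0..1} (\<lambda>x. w (x, y) * of_real (D 1 0 (x, y)) + wx (x, y) * of_real (\<phi> (x, y))) =
      w (1, y) * of_real (\<phi> (1, y)) - w (0, y) * of_real (\<phi> (0, y))" for y
      using wx Dx[of 0 0]
      by (intro integral_derivative_unit_interval[of "\<lambda>x. w (x, y) * of_real (\<phi> (x, y))"] 
            has_vector_derivative_mult has_vector_derivative_of_real)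
        (auto simp: D0)
    then show ?thesis
      using c by (subst integral_Omega_continuous') (auto intro!: continuous_intros simp: zero)
  qed
  then show "(LINT z|lebesgue_on Omega. w z * of_real (d_x \<phi> z)) = - (LINT z|lebesgue_on Omega. fst (wx z, wy z) * of_real (\<phi> z))"
    using int c by (simp add: dx add_eq_0_iff)
  have "(LINT z|lebesgue_on Omega. w z * of_real (D 0 1 z) + wy z * of_real (\<phi> z)) = 0"
  proof -
    have "integral {0..1} (\<lambda>y. w (x, y) * of_real (D 0 1 (x, y)) + wy (x, y) * of_real (\<phi> (x, y))) =
      w (x, 1) * of_real (\<phi> (x, 1)) - w (x, 0) * of_real (\<phi> (x, 0))" for x
      using wy Dy[of 0 0]
      by (intro integral_derivative_unit_interval[of "\<lambda>y. w (x, y) * of_real (\<phi> (x, y))"] 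
            has_vector_derivative_mult has_vector_derivative_of_real)
        (auto simp: D0)
    then show ?thesis
      using c by (subst integral_Omega_continuous) (auto intro!: continuous_intros simp: zero)
  qed
  then show "(LINT z|lebesgue_on Omega. w z * of_real (d_y \<phi> z)) = - (LINT z|lebesgue_on Omega. snd (wx z, wy z) * of_real (\<phi> z))"
    using int c by (simp add: dy add_eq_0_iff)
qed

lemma test_function_L2_on:
  assumes "test_function S \<phi>"
  shows "L2_on Omega \<phi>" "L2_on Omega (d_x \<phi>)" "L2_on Omega (d_y \<phi>)"
proof -
  obtain D where D0: "D 0 0 = \<phi>"
    and Dc: "\<And>i j. continuous_on UNIV (D i j)"
    and Dx: "\<And>i j x y. ((\<lambda>t. D i j (t, y)) has_real_derivative D (Suc i) j (x, y)) (at x)"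
    and Dy: "\<And>i j x y. ((\<lambda>t. D i j (x, t)) has_real_derivative D i (Suc j) (x, y)) (at y)"
    using assms unfolding test_function_def smooth_plane_def by blast
  have "d_x \<phi> = D 1 0" "d_y \<phi> = D 0 1"
    using DERIV_imp_deriv[OF Dx[of 0 0]] DERIV_imp_deriv[OF Dy[of 0 0]]
    by (auto simp: d_x_def d_y_def fun_eq_iff D0)
  then show "L2_on Omega \<phi>" "L2_on Omega (d_x \<phi>)" "L2_on Omega (d_y \<phi>)"
    using Dc D0 by (auto intro!: L2_on_Omega_continuous)
qed

lemma L2_pairing_tendsto:
  fixes u :: "'a::euclidean_space \<Rightarrow> complex"
  assumes u: "L2_on S u" and s: "\<And>n. L2_on S (s n)" and \<psi>: "L2_on S \<psi>"
    and lim: "(\<lambda>n. L2_norm S (\<lambda>z. u z - s n z)) \<longlonglongrightarrow> 0"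
  shows "(\<lambda>n. LINT z|lebesgue_on S. s n z * of_real (\<psi> z)) \<longlonglongrightarrow> (LINT z|lebesgue_on S. u z * of_real (\<psi> z))"
proof (rule LIM_zero_cancel, rule Lim_null_comparison)
  show "(\<lambda>n. L2_norm S (\<lambda>z. u z - s n z) * L2_norm S \<psi>) \<longlonglongrightarrow> 0"
    by (rule tendsto_mult_left_zero[OF lim])
  have "norm ((LINT z|lebesgue_on S. s n z * of_real (\<psi> z)) - (LINT z|lebesgue_on S. u z * of_real (\<psi> z)))
      \<le> L2_norm S (\<lambda>z. u z - s n z) * L2_norm S \<psi>" for n
  proof -
    have "(LINT z|lebesgue_on S. u z * of_real (\<psi> z)) - (LINT z|lebesgue_on S. s n z * of_real (\<psi> z)) =
        (LINT z|lebesgue_on S. (u z - s n z) * of_real (\<psi> z))"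
      using L2_Cauchy_Schwarz_mult(1)[OF u \<psi>] L2_Cauchy_Schwarz_mult(1)[OF s \<psi>]
      by (simp add: left_diff_distrib)
    then show ?thesis
      using L2_Cauchy_Schwarz_mult(2)[OF L2_on_diff[OF u s[of n]] \<psi>] by (simp add: norm_minus_commute)
  qed
  then show "\<forall>\<^sub>F n in sequentially. norm ((LINT z|lebesgue_on S. s n z * of_real (\<psi> z)) - (LINT z|lebesgue_on S. u z * of_real (\<psi> z)))
      \<le> L2_norm S (\<lambda>z. u z - s n z) * L2_norm S \<psi>"
    by simp
qed

lemma L2_norm_component_le:
  fixes G :: "'a::euclidean_space \<Rightarrow> complex \<times> complex"
  assumes "L2_on S G"
  shows "L2_on S (\<lambda>z. fst (G z))" "L2_on S (\<lambda>z. snd (G z))"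
    and "L2_norm S (\<lambda>z. fst (G z)) \<le> L2_norm S G" "L2_norm S (\<lambda>z. snd (G z)) \<le> L2_norm S G"
proof -
  have [measurable]: "G \<in> borel_measurable (lebesgue_on S)"
    and i: "integrable (lebesgue_on S) (\<lambda>z. (norm (G z))\<^sup>2)"
    using assms by (auto simp: L2_on_def)
  have le: "(norm (fst p))\<^sup>2 \<le> (norm p)\<^sup>2" "(norm (snd p))\<^sup>2 \<le> (norm p)\<^sup>2" for p :: "complex \<times> complex"
    by (simp_all add: norm_prod_def)
  have m: "(\<lambda>z. fst (G z)) \<in> borel_measurable (lebesgue_on S)"
    "(\<lambda>z. snd (G z)) \<in> borel_measurable (lebesgue_on S)"
    by (rule borel_measurable_continuous_on[where g=G]; simp add: continuous_on_fst continuous_on_snd)+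
  have "integrable (lebesgue_on S) (\<lambda>z. (norm (fst (G z)))\<^sup>2)"
    by (rule Bochner_Integration.integrable_bound[OF i]) (use m le in simp_all)
  then show f: "L2_on S (\<lambda>z. fst (G z))"
    using m by (simp add: L2_on_def)
  have "integrable (lebesgue_on S) (\<lambda>z. (norm (snd (G z)))\<^sup>2)"
    by (rule Bochner_Integration.integrable_bound[OF i]) (use m le in simp_all)
  then show s: "L2_on S (\<lambda>z. snd (G z))"
    using m by (simp add: L2_on_def)
  show "L2_norm S (\<lambda>z. fst (G z)) \<le> L2_norm S G" "L2_norm S (\<lambda>z. snd (G z)) \<le> L2_norm S G"
    unfolding L2_norm_def using f s i
    by (auto intro!: integral_mono le simp: L2_on_def)
qed

text \<open>The weak gradient is a closed operator: for a fixed test function both sides of its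
  defining identity are continuous in L2, and each component of G - H n is dominated by the norm of
  the pair.\<close>

lemma weak_gradient_limit:
  assumes u: "L2_on Omega u" and G: "L2_on Omega G"
    and s: "\<And>n. weak_gradient Omega (s n) (H n)"
    and lim_u: "(\<lambda>n. L2_norm Omega (\<lambda>z. u z - s n z)) \<longlonglongrightarrow> 0"
    and lim_G: "(\<lambda>n. L2_norm Omega (\<lambda>z. G z - H n z)) \<longlonglongrightarrow> 0"
  shows "weak_gradient Omega u G"
  unfolding weak_gradient_def
proof (intro conjI allI impI)
  fix \<phi> assume \<phi>: "test_function Omega \<phi>"
  note L = test_function_L2_on[OF \<phi>]
  have L2: "L2_on Omega (s n)" "L2_on Omega (H n)" for n
    using s by (auto simp: weak_gradient_def)
  note d = L2_on_diff[OF G L2(2)]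
  have 1: "(\<lambda>n. L2_norm Omega (\<lambda>z. fst (G z) - fst (H n z))) \<longlonglongrightarrow> 0"
    by (rule Lim_null_comparison[OF _ lim_G])
      (use L2_norm_component_le(3)[OF d] in \<open>auto simp: L2_norm_nonneg\<close>)
  have 2: "(\<lambda>n. L2_norm Omega (\<lambda>z. snd (G z) - snd (H n z))) \<longlonglongrightarrow> 0"
    by (rule Lim_null_comparison[OF _ lim_G])
      (use L2_norm_component_le(4)[OF d] in \<open>auto simp: L2_norm_nonneg\<close>)
  have "(\<lambda>n. LINT z|lebesgue_on Omega. s n z * of_real (d_x \<phi> z)) \<longlonglongrightarrow> - (LINT z|lebesgue_on Omega. fst (G z) * of_real (\<phi> z))"
    using tendsto_minus[OF L2_pairing_tendsto[OF L2_norm_component_le(1)[OF G] L2_norm_component_le(1)[OF L2(2)] L(1) 1]]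
      s \<phi> by (simp add: weak_gradient_def)
  then show "(LINT z|lebesgue_on Omega. u z * of_real (d_x \<phi> z)) = - (LINT z|lebesgue_on Omega. fst (G z) * of_real (\<phi> z))"
    using L2_pairing_tendsto[OF u L2(1) L(2) lim_u] LIMSEQ_unique by blast
  have "(\<lambda>n. LINT z|lebesgue_on Omega. s n z * of_real (d_y \<phi> z)) \<longlonglongrightarrow> - (LINT z|lebesgue_on Omega. snd (G z) * of_real (\<phi> z))"
    using tendsto_minus[OF L2_pairing_tendsto[OF L2_norm_component_le(2)[OF G] L2_norm_component_le(2)[OF L2(2)] L(1) 2]]
      s \<phi> by (simp add: weak_gradient_def)
  then show "(LINT z|lebesgue_on Omega. u z * of_real (d_y \<phi> z)) = - (LINT z|lebesgue_on Omega. snd (G z) * of_real (\<phi> z))"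
    using L2_pairing_tendsto[OF u L2(1) L(3) lim_u] LIMSEQ_unique by blast
qed (rule u, rule G)

text \<open>Inner products of two terms, and of two gradients, split into integrals in x and
  integrals in y. Orthogonality of \<open>X\<close> and of \<open>X'\<close> kills those with m
  \<noteq> n, so the series and the series of gradients are both orthogonal, with majorants
  \<open>d\<close> and \<open>c\<close>. The second claim treats every L2 sum u, since the sum is
  determined only up to a null set.\<close>

lemma separated_series:
  fixes a :: "nat \<Rightarrow> complex" and X X' V V' :: "nat \<Rightarrow> real \<Rightarrow> real"
  assumes dX: "\<And>n x. (X n has_real_derivative X' n x) (at x)" and cX': "\<And>n. continuous_on UNIV (X' n)"
    and dV: "\<And>n x. (V n has_real_derivative V' n x) (at x)" and cV': "\<And>n. continuous_on UNIV (V' n)"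
    and orth: "\<And>m n. m \<noteq> n \<Longrightarrow> integral {0..1} (\<lambda>x. X m x * X n x) = 0"
    and orth': "\<And>m n. m \<noteq> n \<Longrightarrow> integral {0..1} (\<lambda>x. X' m x * X' n x) = 0"
    and X: "\<And>n. integral {0..1} (\<lambda>x. (X n x)\<^sup>2) \<le> 1" and X': "\<And>n. integral {0..1} (\<lambda>x. (X' n x)\<^sup>2) \<le> (\<mu> n)\<^sup>2"
    and c: "\<And>n. (cmod (a n))\<^sup>2 * ((\<mu> n)\<^sup>2 * integral {0..1} (\<lambda>y. (V n y)\<^sup>2) + integral {0..1} (\<lambda>y. (V' n y)\<^sup>2)) \<le> c n"
    and d: "\<And>n. (cmod (a n))\<^sup>2 * integral {0..1} (\<lambda>y. (V n y)\<^sup>2) \<le> d n"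
    and sum: "summable c" "summable d"
  defines "f \<equiv> \<lambda>n z. a n * of_real (X n (fst z)) * of_real (V n (snd z))"
  shows "\<exists>u. L2_sums Omega f u"
    and "L2_sums Omega f u \<Longrightarrow>
      \<exists>G. weak_gradient Omega u G \<and> L2_norm Omega G \<le> sqrt (suminf c) \<and> L2_norm Omega u \<le> sqrt (suminf d)"
proof -
  define fx where "fx n z = a n * of_real (X' n (fst z)) * of_real (V n (snd z))" for n z
  define fy where "fy n z = a n * of_real (X n (fst z)) * of_real (V' n (snd z))" for n z
  have cX: "continuous_on UNIV (X n)" and cV: "continuous_on UNIV (V n)" for n
    using dX dV by (auto intro!: DERIV_continuous_on)
  have comp: "continuous_on UNIV (\<lambda>z::real\<times>real. g (fst z))" "continuous_on UNIV (\<lambda>z::real\<times>real. g (snd z))"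
    if "continuous_on UNIV g" for g :: "real \<Rightarrow> real"
    by (auto intro!: continuous_on_compose2[OF that] continuous_intros)
  have cont: "continuous_on UNIV (f n)" "continuous_on UNIV (fx n)" "continuous_on UNIV (fy n)" for n
    unfolding f_def fx_def fy_def
    by (intro continuous_intros comp cX cV cX' cV')+
  have L2: "L2_on Omega (f n)" "L2_on Omega (\<lambda>z. (fx n z, fy n z))" for n
    using cont by (auto intro!: L2_on_Omega_continuous continuous_intros)
  have prod: "integral\<^sup>L (lebesgue_on Omega) (\<lambda>z. (p (fst z) * q (fst z)) * (r (snd z) * s (snd z))) =
      integral {0..1} (\<lambda>x. p x * q x) * integral {0..1} (\<lambda>y. r y * s y)"
    if "continuous_on UNIV p" "continuous_on UNIV q" "continuous_on UNIV r" "continuous_on UNIV s"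
    for p q r s :: "real \<Rightarrow> real"
    using that by (intro integral_Omega_product continuous_intros)
  have int: "integrable (lebesgue_on Omega) (\<lambda>z. (p (fst z) * q (fst z)) * (r (snd z) * s (snd z)))"
    if "continuous_on UNIV p" "continuous_on UNIV q" "continuous_on UNIV r" "continuous_on UNIV s"
    for p q r s :: "real \<Rightarrow> real"
    using that by (intro integrable_Omega_continuous continuous_intros comp)
  have f_inner: "(LINT z|lebesgue_on Omega. f m z \<bullet> f n z) =
      (a m \<bullet> a n) * (integral {0..1} (\<lambda>x. X m x * X n x) * integral {0..1} (\<lambda>y. V m y * V n y))" for m n
  proof -
    have "f m z \<bullet> f n z = (a m \<bullet> a n) * ((X m (fst z) * X n (fst z)) * (V m (snd z) * V n (snd z)))" for z
      by (simp add: f_def inner_complex_def algebra_simps)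
    then show ?thesis
      by (simp only: integral_mult_right_zero prod[OF cX cX cV cV])
  qed
  have G_inner: "(LINT z|lebesgue_on Omega. (fx m z, fy m z) \<bullet> (fx n z, fy n z)) =
      (a m \<bullet> a n) * (integral {0..1} (\<lambda>x. X' m x * X' n x) * integral {0..1} (\<lambda>y. V m y * V n y)
        + integral {0..1} (\<lambda>x. X m x * X n x) * integral {0..1} (\<lambda>y. V' m y * V' n y))" for m n
  proof -
    have "(fx m z, fy m z) \<bullet> (fx n z, fy n z) = (a m \<bullet> a n) * ((X' m (fst z) * X' n (fst z)) * (V m (snd z) * V n (snd z))
       + (X m (fst z) * X n (fst z)) * (V' m (snd z) * V' n (snd z)))" for z
      by (simp add: fx_def fy_def inner_complex_def algebra_simps)
    then show ?thesis
      by (simp only: integral_mult_right_zero prod[OF cX' cX' cV cV] prod[OF cX cX cV' cV']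
         Bochner_Integration.integral_add[OF int[OF cX' cX' cV cV] int[OF cX cX cV' cV']])
  qed
  have V0: "0 \<le> integral {0..1} (\<lambda>y. (V n y)\<^sup>2)" "0 \<le> integral {0..1} (\<lambda>y. (V' n y)\<^sup>2)" for n
    by (auto intro!: integral_nonneg integrable_continuous_interval continuous_intros
      continuous_on_subset[OF cV] continuous_on_subset[OF cV'])
  have fd: "(L2_norm Omega (f n))\<^sup>2 \<le> d n" for n
  proof -
    have "(L2_norm Omega (f n))\<^sup>2 = (cmod (a n))\<^sup>2 * (integral {0..1} (\<lambda>x. (X n x)\<^sup>2) * integral {0..1} (\<lambda>y. (V n y)\<^sup>2))"
      unfolding L2_norm_power2 power2_norm_eq_inner f_inner by (simp add: power2_eq_square)
    also have "\<dots> \<le> (cmod (a n))\<^sup>2 * (1 * integral {0..1} (\<lambda>y. (V n y)\<^sup>2))"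
      using X V0 by (intro mult_left_mono mult_right_mono) auto
    also have "\<dots> \<le> d n" using d by simp
    finally show ?thesis .
  qed
  have Gc: "(L2_norm Omega (\<lambda>z. (fx n z, fy n z)))\<^sup>2 \<le> c n" for n
  proof -
    have "(L2_norm Omega (\<lambda>z. (fx n z, fy n z)))\<^sup>2 = (cmod (a n))\<^sup>2 *
       (integral {0..1} (\<lambda>x. (X' n x)\<^sup>2) * integral {0..1} (\<lambda>y. (V n y)\<^sup>2) + integral {0..1} (\<lambda>x. (X n x)\<^sup>2) * integral {0..1} (\<lambda>y. (V' n y)\<^sup>2))"
      unfolding L2_norm_power2 power2_norm_eq_inner G_inner by (simp add: power2_eq_square)
    also have "\<dots> \<le> (cmod (a n))\<^sup>2 * ((\<mu> n)\<^sup>2 * integral {0..1} (\<lambda>y. (V n y)\<^sup>2) + 1 * integral {0..1} (\<lambda>y. (V' n y)\<^sup>2))"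
      using X X' V0 by (intro mult_left_mono add_mono mult_right_mono) auto
    also have "\<dots> \<le> c n" using c by simp
    finally show ?thesis .
  qed
  have lm: "Omega \<in> lmeasurable" by (simp add: Omega_eq_box)
  have of: "(LINT z|lebesgue_on Omega. f m z \<bullet> f n z) = 0" if "m \<noteq> n" for m n
    using orth[OF that] f_inner by simp
  have oG: "(LINT z|lebesgue_on Omega. (fx m z, fy m z) \<bullet> (fx n z, fy n z)) = 0" if "m \<noteq> n" for m n
    unfolding G_inner using orth[OF that] orth'[OF that] by simp
  note sf = L2_orthogonal_series[OF lm L2(1) of fd sum(2)]
  note sG = L2_orthogonal_series[OF lm L2(2) oG Gc sum(1)]
  show "\<exists>u. L2_sums Omega f u"
    using sf(1) L2(1) by (auto simp: L2_sums_def)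
  assume u: "L2_sums Omega f u"
  obtain G where G: "L2_on Omega G" "(\<lambda>N. L2_norm Omega (\<lambda>z. G z - (\<Sum>n<N. (fx n z, fy n z)))) \<longlonglongrightarrow> 0"
    using sG(1) by auto
  have "weak_gradient Omega (\<lambda>z. \<Sum>n<N. f n z) (\<lambda>z. (\<Sum>n<N. (fx n z, fy n z)))" for N
  proof -
    have "weak_gradient Omega (\<lambda>z. \<Sum>n<N. f n z) (\<lambda>z. (\<Sum>n<N. fx n z, \<Sum>n<N. fy n z))"
    proof (rule weak_gradient_C1)
      show "continuous_on UNIV (\<lambda>z. \<Sum>n<N. f n z)" "continuous_on UNIV (\<lambda>z. \<Sum>n<N. fx n z)"
         "continuous_on UNIV (\<lambda>z. \<Sum>n<N. fy n z)"
        by (intro continuous_intros cont)+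
      show "((\<lambda>t. \<Sum>n<N. f n (t, y)) has_vector_derivative (\<Sum>n<N. fx n (x, y))) (at x)" for x y
        unfolding f_def fx_def fst_conv snd_conv
        by (intro has_vector_derivative_sum has_vector_derivative_mult_left has_vector_derivative_mult_right
            has_vector_derivative_of_real dX)
      show "((\<lambda>t. \<Sum>n<N. f n (x, t)) has_vector_derivative (\<Sum>n<N. fy n (x, y))) (at y)" for x y
        unfolding f_def fy_def fst_conv snd_conv
        by (intro has_vector_derivative_sum has_vector_derivative_mult_right
            has_vector_derivative_of_real dV)
    qed
    then show ?thesis by (simp add: sum_prod)
  qed
  then have "weak_gradient Omega u G"
    using u by (intro weak_gradient_limit[OF _ G(1) _ _ G(2)]) (auto simp: L2_sums_def)
  moreover have "L2_norm Omega G \<le> sqrt (suminf c)"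
    by (rule L2_norm_le_of_limit[OF G(1) _ G(2)]) (intro L2_on_sum L2, rule sG(2))
  moreover have "L2_norm Omega u \<le> sqrt (suminf d)"
    by (rule L2_norm_le_of_limit[where s="\<lambda>N z. \<Sum>n<N. f n z"])
      (use u sf(2) in \<open>auto simp: L2_sums_def intro!: L2_on_sum\<close>)
  ultimately show "\<exists>G. weak_gradient Omega u G \<and> L2_norm Omega G \<le> sqrt (suminf c) \<and> L2_norm Omega u \<le> sqrt (suminf d)"
    by blast
qed

subsection \<open>The ordinary differential equation\<close>

text \<open>\<open>cosl l\<close> and \<open>sinl l\<close> are the solutions of Z'' + l Z = 0 with
  initial values (1, 0) and (0, 1), for every real l; the value t of \<open>sinl\<close> at l = 0 is
  the limit from both sides. The sign of l thus enters the estimates but not the representation of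
  solutions.\<close>

definition cosl :: "real \<Rightarrow> real \<Rightarrow> real" where
  "cosl l t = (if l \<ge> 0 then cos (sqrt l * t) else cosh (sqrt (- l) * t))"

definition sinl :: "real \<Rightarrow> real \<Rightarrow> real" where
  "sinl l t = (if l = 0 then t else if l > 0 then sin (sqrt l * t) / sqrt l
     else sinh (sqrt (- l) * t) / sqrt (- l))"

lemma cosl_has_derivative: "(cosl l has_real_derivative - l * sinl l t) (at t)"
proof -
  consider "l = 0" | "l > 0" | "l < 0" by linarith
  then show ?thesis
  proof cases
    case 2
    then have "((\<lambda>t. cos (sqrt l * t)) has_real_derivative - sin (sqrt l * t) * sqrt l) (at t)"
      by (auto intro!: derivative_eq_intros)
    moreover have "- l * sinl l t = - sin (sqrt l * t) * sqrt l"
      using 2 real_sqrt_mult_self[of l] by (simp add: sinl_def divide_simps)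
    ultimately show ?thesis using 2 by (simp add: cosl_def[abs_def])
  next
    case 3
    then have "((\<lambda>t. cosh (sqrt (- l) * t)) has_real_derivative sinh (sqrt (- l) * t) * sqrt (- l)) (at t)"
      by (auto intro!: derivative_eq_intros)
    moreover have "- l * sinl l t = sinh (sqrt (- l) * t) * sqrt (- l)"
      using 3 by (simp add: sinl_def divide_simps mult.assoc)
    ultimately show ?thesis using 3 by (simp add: cosl_def[abs_def])
  qed (simp add: cosl_def[abs_def])
qed

lemma sinl_has_derivative: "(sinl l has_real_derivative cosl l t) (at t)"
proof -
  consider "l = 0" | "l > 0" | "l < 0" by linarith
  then show ?thesis
  proof cases
    case 2
    then have "((\<lambda>t. sin (sqrt l * t) / sqrt l) has_real_derivative cos (sqrt l * t)) (at t)"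
      by (auto intro!: derivative_eq_intros simp: mult.assoc)
    with 2 show ?thesis
      by (simp add: cosl_def sinl_def[abs_def])
  next
    case 3
    then have "((\<lambda>t. sinh (sqrt (- l) * t) / sqrt (- l)) has_real_derivative cosh (sqrt (- l) * t)) (at t)"
      by (auto intro!: derivative_eq_intros simp: mult.assoc)
    with 3 show ?thesis
      by (simp add: cosl_def sinl_def[abs_def])
  qed (simp add: cosl_def sinl_def[abs_def])
qed

lemma cosl_sinl_0 [simp]: "cosl l 0 = 1" "sinl l 0 = 0"
  by (auto simp: cosl_def sinl_def)

text \<open>This is the Wronskian of the pair; it serves to recover a solution from its two
  coefficients.\<close>

lemma cosl_sinl_power2: "(cosl l t)\<^sup>2 + l * (sinl l t)\<^sup>2 = 1"
proof -
  consider "l = 0" | "l > 0" | "l < 0" by linarith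
  then show ?thesis
    by cases (auto simp: cosl_def sinl_def power_divide cosh_square_eq)
qed

text \<open>Two bounds for \<open>sinl\<close> are kept: 1, which follows from |sin x| \<le> |x| and
  survives as l tends to 0, and 1 / sqrt l, which is better for large l.\<close>

lemma cosl_sinl_osc:
  assumes "l \<ge> 0" "0 \<le> t" "t \<le> 1"
  shows "\<bar>cosl l t\<bar> \<le> 1" "\<bar>sinl l t\<bar> \<le> 1" "sqrt l * \<bar>sinl l t\<bar> \<le> 1"
    and "cosl l 1 = cos (sqrt l)" "sqrt l * sinl l 1 = sin (sqrt l)"
proof -
  have "\<bar>sin (sqrt l * t)\<bar> \<le> sqrt l * 1"
    using abs_sin_x_le_abs_x[of "sqrt l * t"] mult_left_mono[of t 1 "sqrt l"] assms by auto
  then show "\<bar>sinl l t\<bar> \<le> 1"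
    using assms by (auto simp: sinl_def abs_mult divide_simps)
qed (use assms in \<open>auto simp: cosl_def sinl_def abs_mult\<close>)

lemma sinh_le_mult_cosh:
  assumes "(x::real) \<ge> 0"
  shows "sinh x \<le> x * cosh x"
proof -
  have "(\<lambda>x. x * cosh x - sinh x) 0 \<le> (\<lambda>x. x * cosh x - sinh x) x"
  proof (rule DERIV_nonneg_imp_nondecreasing[OF assms])
    fix y :: real assume "0 \<le> y" "y \<le> x"
    moreover have "((\<lambda>x. x * cosh x - sinh x) has_real_derivative y * sinh y) (at y)"
      by (auto intro!: derivative_eq_intros)
    ultimately show "\<exists>z. ((\<lambda>x. x * cosh x - sinh x) has_real_derivative z) (at y) \<and> 0 \<le> z"
      by (intro exI[of _ "y * sinh y"]) auto
  qed
  then show ?thesis by simp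
qed

text \<open>Equivalent to 3 \<le> exp (2 x). It bounds coth \<kappa> by 2 when
  \<open>B1 = B3\<close>, where nonresonance forces \<kappa> \<ge> 1.\<close>

lemma cosh_le_2_sinh:
  assumes "(x::real) \<ge> 1"
  shows "cosh x \<le> 2 * sinh x"
proof -
  have "3 \<le> exp (2 * x)"
    using exp_ge_add_one_self[of "2 * x"] assms by linarith
  then have "3 * exp (- x) \<le> exp (2 * x) * exp (- x)"
    by (intro mult_right_mono) auto
  also have "exp (2 * x) * exp (- x) = exp x"
    by (simp flip: exp_add)
  finally show ?thesis
    by (simp add: cosh_def sinh_def)
qed

lemma cosl_sinl_hyp:
  assumes "\<kappa> > 0" "0 \<le> t" "t \<le> 1"
  shows "\<bar>cosl (- \<kappa>\<^sup>2) t\<bar> \<le> cosh \<kappa>" "\<kappa> * \<bar>sinl (- \<kappa>\<^sup>2) t\<bar> \<le> sinh \<kappa>"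
    and "\<bar>sinl (- \<kappa>\<^sup>2) t\<bar> \<le> cosh \<kappa>"
    and "cosl (- \<kappa>\<^sup>2) 1 = cosh \<kappa>" "\<kappa> * sinl (- \<kappa>\<^sup>2) 1 = sinh \<kappa>"
proof -
  have le: "\<kappa> * t \<le> \<kappa>" using assms by simp
  show "\<bar>cosl (- \<kappa>\<^sup>2) t\<bar> \<le> cosh \<kappa>"
    using assms le by (auto simp: cosl_def cosh_real_nonneg_le_iff)
  show *: "\<kappa> * \<bar>sinl (- \<kappa>\<^sup>2) t\<bar> \<le> sinh \<kappa>"
    using assms le by (auto simp: sinl_def)
  have "\<kappa> * \<bar>sinl (- \<kappa>\<^sup>2) t\<bar> \<le> \<kappa> * cosh \<kappa>"
    using * sinh_le_mult_cosh[of \<kappa>] assms by linarith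
  then show "\<bar>sinl (- \<kappa>\<^sup>2) t\<bar> \<le> cosh \<kappa>"
    using assms by simp
qed (use assms in \<open>auto simp: cosl_def sinl_def\<close>)

text \<open>The parameters b and c are the value and the derivative at y = 1, so the condition there
  sets one of them to 0 and leaves a single coefficient to be fixed at y = 0.\<close>

definition sol :: "real \<Rightarrow> real \<Rightarrow> real \<Rightarrow> real \<Rightarrow> real" where
  "sol l b c y = b * cosl l (1 - y) - c * sinl l (1 - y)"

definition sol' :: "real \<Rightarrow> real \<Rightarrow> real \<Rightarrow> real \<Rightarrow> real" where
  "sol' l b c y = l * b * sinl l (1 - y) + c * cosl l (1 - y)"

lemma sol_has_derivative: "(sol l b c has_real_derivative sol' l b c y) (at y)"
  unfolding sol_def[abs_def] sol'_def
  by (rule derivative_eq_intros DERIV_chain2[OF cosl_has_derivative] DERIV_chain2[OF sinl_has_derivative] refl)+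
    (simp add: algebra_simps)

lemma sol'_has_derivative: "(sol' l b c has_real_derivative - l * sol l b c y) (at y)"
  unfolding sol_def sol'_def[abs_def]
  by (rule derivative_eq_intros DERIV_chain2[OF cosl_has_derivative] DERIV_chain2[OF sinl_has_derivative] refl)+
    (simp add: algebra_simps)

lemma sol_at_1 [simp]: "sol l b c 1 = b" "sol' l b c 1 = c"
  by (simp_all add: sol_def sol'_def)

lemma continuous_on_sol: "continuous_on A (sol l b c)" "continuous_on A (sol' l b c)"
  using sol_has_derivative sol'_has_derivative
  by (meson DERIV_isCont continuous_at_imp_continuous_on)+

text \<open>Let C and S be \<open>cosl\<close> and \<open>sinl\<close> at 1 - y. By the equation, Y'
  S + Y C and Y' C - l Y S have derivative 0 on the open interval; their constant values are b and
  c. The identity then extends to the end points by continuity.\<close>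

lemma is_Y_solution_eq_sol:
  assumes "is_Y_solution B1 B3 k \<mu> Y"
  defines "l \<equiv> k\<^sup>2 - \<mu>\<^sup>2"
  obtains b c where "\<And>y. y \<in> {0..1} \<Longrightarrow> Y y = sol l b c y"
    and "bdry_op B1 (-1) (sol l b c) (sol' l b c) 0 = 1"
    and "bdry_op B3 1 (sol l b c) (sol' l b c) 1 = 0"
proof -
  obtain Y' Y'' where Y: "\<And>y. y \<in> {0..1} \<Longrightarrow> (Y has_real_derivative Y' y) (at y within {0..1})"
    and Y': "\<And>y. y \<in> {0<..<1} \<Longrightarrow> (Y' has_real_derivative Y'' y) (at y)"
    and ode: "\<And>y. y \<in> {0<..<1} \<Longrightarrow> Y'' y = - l * Y y"
    and b1: "bdry_op B1 (-1) Y Y' 0 = 1" and b3: "bdry_op B3 1 Y Y' 1 = 0"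
    using assms(1) unfolding is_Y_solution_def l_def minus_mult_left[symmetric] eq_neg_iff_add_eq_0
    by blast
  have Yi: "(Y has_real_derivative Y' y) (at y)" if "y \<in> {0<..<1}" for y
  proof -
    have "at y within {0..1} = at y"
      using that by (intro at_within_interior) auto
    then show ?thesis using Y[of y] that by simp
  qed
  let ?C = "\<lambda>y. cosl l (1 - y)" and ?S = "\<lambda>y. sinl l (1 - y)"
  have C: "(?C has_real_derivative l * ?S y) (at y)" for y
    by (rule DERIV_cong[OF DERIV_chain2[OF cosl_has_derivative]]) (rule derivative_eq_intros refl | simp)+
  have S: "(?S has_real_derivative - ?C y) (at y)" for y
    by (rule DERIV_cong[OF DERIV_chain2[OF sinl_has_derivative]]) (rule derivative_eq_intros refl | simp)+
  have "\<exists>b. \<forall>y\<in>{0<..<1}. Y' y * ?S y + Y y * ?C y = b"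
  proof (rule has_field_derivative_zero_constant)
    fix y :: real assume y: "y \<in> {0<..<1}"
    show "((\<lambda>y. Y' y * ?S y + Y y * ?C y) has_real_derivative 0) (at y within {0<..<1})"
      by (rule has_field_derivative_at_within)
        (rule derivative_eq_intros Yi[OF y] Y'[OF y] C S refl | simp add: ode[OF y])+
  qed auto
  then obtain b where b: "\<And>y. y \<in> {0<..<1} \<Longrightarrow> Y' y * ?S y + Y y * ?C y = b" by blast
  have "\<exists>c. \<forall>y\<in>{0<..<1}. Y' y * ?C y - l * Y y * ?S y = c"
  proof (rule has_field_derivative_zero_constant)
    fix y :: real assume y: "y \<in> {0<..<1}"
    show "((\<lambda>y. Y' y * ?C y - l * Y y * ?S y) has_real_derivative 0) (at y within {0<..<1})"
      by (rule has_field_derivative_at_within)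
        (rule derivative_eq_intros Yi[OF y] Y'[OF y] C S refl | simp add: ode[OF y])+
  qed auto
  then obtain c where c: "\<And>y. y \<in> {0<..<1} \<Longrightarrow> Y' y * ?C y - l * Y y * ?S y = c" by blast
  have "Y y - sol l b c y = 0" if "y \<in> {0..1}" for y
  proof (rule continuous_constant_on_closure[where S="{0<..<1}" and f="\<lambda>y. Y y - sol l b c y"])
    show "continuous_on (closure {0<..<1}) (\<lambda>y. Y y - sol l b c y)"
      using DERIV_continuous_on[OF Y] by (auto intro!: continuous_intros continuous_on_sol)
    fix y :: real assume y: "y \<in> {0<..<1}"
    \<comment> \<open>On inserting the two constants the terms with Y' cancel and Y times the
      Wronskian is left.\<close>
    have "sol l b c y = Y y * ((?C y)\<^sup>2 + l * (?S y)\<^sup>2)"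
      unfolding sol_def b[OF y, symmetric] c[OF y, symmetric] by (simp add: algebra_simps power2_eq_square)
    then show "Y y - sol l b c y = 0"
      by (simp add: cosl_sinl_power2)
  qed (use that in auto)
  then have eq: "Y y = sol l b c y" if "y \<in> {0..1}" for y
    using that by simp
  \<comment> \<open>The equation says nothing about Y' at the end points, where the boundary
    operators read it; there Y' is fixed as the one-sided derivative of Y, which is unique.\<close>
  have eq': "Y' y = sol' l b c y" if "y \<in> {0..1}" for y
  proof (rule vector_derivative_unique_within_closed_interval[where a=0 and b=1 and x=y and f=Y])
    show "(Y has_vector_derivative Y' y) (at y within cbox 0 1)"
      using Y[OF that] by (simp add: has_real_derivative_iff_has_vector_derivative)
    have "(Y has_real_derivative sol' l b c y) (at y within {0..1})"
      using that eq
      by (intro has_field_derivative_transform_within[OF has_field_derivative_at_within[OF sol_has_derivative], of 1]) auto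
    then show "(Y has_vector_derivative sol' l b c y) (at y within cbox 0 1)"
      by (simp add: has_real_derivative_iff_has_vector_derivative)
  qed (use that in auto)
  show ?thesis
  proof (rule that[OF eq])
    show "bdry_op B1 (-1) (sol l b c) (sol' l b c) 0 = 1"
      using b1 eq[of 0] eq'[of 0] by (cases B1) auto
    show "bdry_op B3 1 (sol l b c) (sol' l b c) 1 = 0"
      using b3 eq[of 1] eq'[of 1] by (cases B3) auto
  qed auto
qed

section \<open>Sine and cosine away from their zeros\<close>

text \<open>Sine is concave on [0, pi/2] and so lies above its chord.\<close>

lemma Jordan_inequality:
  assumes "0 \<le> x" "x \<le> pi / 2"
  shows "2 * x / pi \<le> sin x"
proof -
  have "convex_on {0..pi / 2} (\<lambda>x. - sin x)"
  proof (rule f''_ge0_imp_convex[where f' = "\<lambda>x. - cos x" and f'' = sin])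
    show "0 \<le> sin x" if "x \<in> {0..pi / 2}" for x
      using that by (intro sin_ge_zero) auto
  qed (auto intro!: derivative_eq_intros)
  then have "- sin ((1 - 2 * x / pi) *\<^sub>R 0 + (2 * x / pi) *\<^sub>R (pi / 2)) \<le> (1 - 2 * x / pi) * - sin 0 + (2 * x / pi) * - sin (pi / 2)"
    using assms by (intro convex_onD) (auto simp: field_simps)
  then show ?thesis by simp
qed

lemma abs_sin_ge:
  assumes "\<bar>x\<bar> \<le> pi / 2"
  shows "2 * \<bar>x\<bar> / pi \<le> \<bar>sin x\<bar>"
  using Jordan_inequality[of "\<bar>x\<bar>"] assms by (auto simp: abs_if split: if_splits)

text \<open>Distance from the spectrum, measured in \<open>\<kappa>\<^sup>2\<close>, is turned into a lower bound for the
  characteristic function by factoring \<open>\<kappa>\<^sup>2 - p\<^sup>2 = (\<kappa> - p) (\<kappa> + p)\<close> at the nearest zero \<open>p\<close>.\<close>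

lemma abs_sin_near_zero_lower_bound:
  assumes "\<kappa> \<ge> 0" "p \<ge> 0" "\<bar>\<kappa> - p\<bar> \<le> pi / 2" "\<bar>\<kappa>\<^sup>2 - p\<^sup>2\<bar> \<ge> pi\<^sup>2 / 8"
  shows "1 \<le> 14 / 3 * max 1 \<kappa> * \<bar>sin (\<kappa> - p)\<bar>"
proof -
  have pi: "3 \<le> pi" using pi_approx by simp
  have "pi\<^sup>2 / 8 \<le> \<bar>\<kappa> - p\<bar> * (\<kappa> + p)"
  proof -
    have "\<kappa>\<^sup>2 - p\<^sup>2 = (\<kappa> - p) * (\<kappa> + p)" by (simp add: power2_eq_square algebra_simps)
    then show ?thesis using assms by (simp add: abs_mult)
  qed
  also have "\<dots> \<le> (pi / 2 * \<bar>sin (\<kappa> - p)\<bar>) * (2 * \<kappa> + pi / 2)"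
  proof (rule mult_mono)
    show "\<bar>\<kappa> - p\<bar> \<le> pi / 2 * \<bar>sin (\<kappa> - p)\<bar>"
      using abs_sin_ge[OF assms(3)] by (simp add: field_simps)
    show "\<kappa> + p \<le> 2 * \<kappa> + pi / 2"
      using assms(3) by linarith
  qed (use assms in auto)
  also have "\<dots> \<le> (pi / 2 * \<bar>sin (\<kappa> - p)\<bar>) * ((2 + pi / 2) * max 1 \<kappa>)"
  proof (intro mult_left_mono)
    have "2 * \<kappa> \<le> 2 * max 1 \<kappa>" "pi / 2 * 1 \<le> pi / 2 * max 1 \<kappa>"
      by (intro mult_left_mono; simp)+
    then show "2 * \<kappa> + pi / 2 \<le> (2 + pi / 2) * max 1 \<kappa>"
      by (simp only: distrib_right)
  qed auto
  finally have "pi * (pi / 8) \<le> pi * ((1 + pi / 4) * (max 1 \<kappa> * \<bar>sin (\<kappa> - p)\<bar>))"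
    by (simp add: power2_eq_square algebra_simps)
  then have "pi / 8 \<le> (1 + pi / 4) * (max 1 \<kappa> * \<bar>sin (\<kappa> - p)\<bar>)"
    by (subst (asm) mult_le_cancel_left_pos) auto
  \<comment> \<open>From 3 \<le> pi follows 1 + pi/4 \<le> pi/3 + pi/4 = 7/12 pi, and 8 * 7/12 is
    the constant 14/3.\<close>
  also have "\<dots> \<le> (7 / 12 * pi) * (max 1 \<kappa> * \<bar>sin (\<kappa> - p)\<bar>)"
    using pi by (intro mult_right_mono) auto
  finally have "pi * 1 \<le> pi * (14 / 3 * max 1 \<kappa> * \<bar>sin (\<kappa> - p)\<bar>)"
    by (simp add: algebra_simps)
  then show ?thesis
    by (subst (asm) mult_le_cancel_left_pos) auto
qed

lemma abs_sin_lower_bound: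
  assumes "\<kappa> \<ge> 0" "\<And>m::nat. pi\<^sup>2 / 8 \<le> \<bar>\<kappa>\<^sup>2 - (real m * pi)\<^sup>2\<bar>"
  shows "1 \<le> 14 / 3 * max 1 \<kappa> * \<bar>sin \<kappa>\<bar>"
proof -
  \<comment> \<open>The nearest multiple of pi is within pi/2 of \<kappa>.\<close>
  define m where "m = nat (round (\<kappa> / pi))"
  have r: "round (\<kappa> / pi) \<ge> 0"
    using assms by (simp add: round_def)
  have "\<bar>real m - \<kappa> / pi\<bar> \<le> 1 / 2"
    using of_int_round_abs_le[of "\<kappa> / pi"] r by (simp add: m_def)
  then have "\<bar>real m - \<kappa> / pi\<bar> * pi \<le> 1 / 2 * pi"
    by (intro mult_right_mono) auto
  also have "\<bar>real m - \<kappa> / pi\<bar> * pi = \<bar>(real m - \<kappa> / pi) * pi\<bar>"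
    by (simp add: abs_mult)
  also have "(real m - \<kappa> / pi) * pi = real m * pi - \<kappa>"
    by (simp add: left_diff_distrib)
  finally have "\<bar>\<kappa> - real m * pi\<bar> \<le> pi / 2"
    by (simp add: abs_minus_commute)
  then have "1 \<le> 14 / 3 * max 1 \<kappa> * \<bar>sin (\<kappa> - real m * pi)\<bar>"
    using assms by (intro abs_sin_near_zero_lower_bound) auto
  also have "\<bar>sin (\<kappa> - real m * pi)\<bar> = \<bar>sin \<kappa>\<bar>"
    by (simp add: sin_diff abs_mult)
  finally show ?thesis .
qed

lemma abs_cos_lower_bound:
  assumes "\<kappa> \<ge> 0" "\<And>m::nat. pi\<^sup>2 / 8 \<le> \<bar>\<kappa>\<^sup>2 - ((real m + 1 / 2) * pi)\<^sup>2\<bar>"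
  shows "1 \<le> 14 / 3 * max 1 \<kappa> * \<bar>cos \<kappa>\<bar>"
proof -
  \<comment> \<open>The floor replaces rounding: (m + 1/2) pi is the midpoint of the interval from m
    pi to (m + 1) pi that contains \<kappa>.\<close>
  define m where "m = nat \<lfloor>\<kappa> / pi\<rfloor>"
  have f: "\<lfloor>\<kappa> / pi\<rfloor> \<ge> 0"
    using assms by simp
  have "real m \<le> \<kappa> / pi" "\<kappa> / pi \<le> real m + 1"
    using of_int_floor_le[of "\<kappa> / pi"] floor_correct[of "\<kappa> / pi"] f by (auto simp: m_def)
  then have "\<bar>\<kappa> - (real m + 1 / 2) * pi\<bar> \<le> pi / 2"
    by (auto simp: abs_le_iff field_simps)
  then have "1 \<le> 14 / 3 * max 1 \<kappa> * \<bar>sin (\<kappa> - (real m + 1 / 2) * pi)\<bar>"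
    using assms by (intro abs_sin_near_zero_lower_bound) auto
  also have "\<bar>sin (\<kappa> - (real m + 1 / 2) * pi)\<bar> = \<bar>cos \<kappa>\<bar>"
    by (simp add: sin_diff distrib_right sin_add cos_add abs_mult)
  finally show ?thesis .
qed


section \<open>Nonresonance of the chosen \<mu>\<close>

text \<open>The infimum in \<open>d0\<close> is attained at j = round (k^2 / pi^2), and t is the
  remainder. This turns the four-case rule into a condition on |t|.\<close>

lemma nearest_integer_cases:
  obtains j :: int and t where "k\<^sup>2 = (of_int j + t) * pi\<^sup>2" "d0 k = \<bar>t\<bar> * pi\<^sup>2" "\<bar>t\<bar> \<le> 1 / 2"
proof -
  define x where "x = k\<^sup>2 / pi\<^sup>2"
  have k: "k\<^sup>2 = x * pi\<^sup>2" by (simp add: x_def)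
  have e: "\<bar>k\<^sup>2 - of_int n * pi\<^sup>2\<bar> = \<bar>x - of_int n\<bar> * pi\<^sup>2" for n
    unfolding k by (simp add: abs_mult flip: left_diff_distrib)
  have "d0 k = \<bar>x - of_int (round x)\<bar> * pi\<^sup>2"
    unfolding d0_def e
  proof (rule cInf_eq_minimum)
    show "\<bar>x - of_int (round x)\<bar> * pi\<^sup>2 \<in> range (\<lambda>n::int. \<bar>x - of_int n\<bar> * pi\<^sup>2)" by blast
  qed (auto intro!: mult_right_mono round_diff_minimal)
  moreover have "\<bar>x - of_int (round x)\<bar> \<le> 1 / 2"
    using of_int_round_abs_le[of x] by (simp add: abs_minus_commute)
  ultimately show ?thesis
    using that[of "round x" "x - of_int (round x)"] k by simp
qed

lemma mu_nonneg: "mu B1 B3 k n \<ge> 0"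
  by (simp add: mu_def)

text \<open>The squares subtracted last include the eigenvalues of the problem in y. As (n + 1/2)^2
  = n^2 + n + 1/4, together with \<mu>^2 they sum to pi^2 times an integer plus r, where r is 1/4 or
  0 if \<open>B1 = B3\<close>, and 1/4 or 1/2 otherwise. In each case the range of |t| keeps t at
  distance 1/8 from r modulo one.\<close>

lemma mu_nonresonance:
  "pi\<^sup>2 / 8 \<le> \<bar>k\<^sup>2 - (mu B1 B3 k n)\<^sup>2 - ((if B1 = B3 then real m else real m + 1 / 2) * pi)\<^sup>2\<bar>"
proof -
  obtain j :: int and t where k: "k\<^sup>2 = (of_int j + t) * pi\<^sup>2" and d: "d0 k = \<bar>t\<bar> * pi\<^sup>2"
    and t: "\<bar>t\<bar> \<le> 1 / 2"
    by (rule nearest_integer_cases)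
  have pi2: "pi\<^sup>2 > 0" by simp
  have d1: "d0 k \<in> {0..pi\<^sup>2 / 8} \<longleftrightarrow> \<bar>t\<bar> \<le> 1 / 8"
    using pi2 unfolding d by (auto simp: field_simps)
  have d2: "d0 k \<in> {3 * pi\<^sup>2 / 8..pi\<^sup>2 / 2} \<longleftrightarrow> 3 / 8 \<le> \<bar>t\<bar>"
    using pi2 t unfolding d by (auto simp: field_simps)
  have shift: "pi\<^sup>2 / 8 \<le> \<bar>k\<^sup>2 - (a * pi)\<^sup>2 - (b * pi)\<^sup>2\<bar>"
    if "a\<^sup>2 + b\<^sup>2 = of_int i + r" "\<And>q::int. 1 / 8 \<le> \<bar>of_int q + t - r\<bar>" for a b r :: real and i :: int
  proof -
    have "k\<^sup>2 - (a * pi)\<^sup>2 - (b * pi)\<^sup>2 = (of_int j + t - (a\<^sup>2 + b\<^sup>2)) * pi\<^sup>2"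
      unfolding k by (simp add: power_mult_distrib algebra_simps)
    also have "\<dots> = (of_int (j - i) + t - r) * pi\<^sup>2"
      unfolding that(1) by simp
    finally show ?thesis
      using mult_right_mono[OF that(2)[of "j - i"], of "pi\<^sup>2"] by (simp add: abs_mult)
  qed
  \<comment> \<open>Since |t| \<le> 1/2 and r is in [0, 1/2], the sum q + t - r has modulus at least
    1 unless q is -1, 0 or 1.\<close>
  have far: "1 / 8 \<le> \<bar>of_int q + t - r\<bar>" if "\<And>q'. q' = - 1 \<or> q' = 0 \<or> q' = 1 \<Longrightarrow> 1 / 8 \<le> \<bar>q' + t - r\<bar>" "r \<in> {0..1/2}"
    for r :: real and q :: int
  proof -
    consider "q \<le> - 2" | "q = - 1" | "q = 0" | "q = 1" | "q \<ge> 2" by linarith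
    then show ?thesis
    proof cases
      case 1
      then have "real_of_int q \<le> - 2" by linarith
      then show ?thesis using t that(2) by (auto simp: abs_if split: if_splits)
    next
      case 5
      then have "real_of_int q \<ge> 2" by linarith
      then show ?thesis using t that(2) by (auto simp: abs_if split: if_splits)
    qed (use that(1)[of "real_of_int q"] in auto)
  qed
  show ?thesis
  proof (cases "B1 = B3")
    case True
    show ?thesis
    proof (cases "\<bar>t\<bar> \<le> 1 / 8")
      case t: True
      have "1 / 8 \<le> \<bar>of_int q + t - 1 / 4\<bar>" for q
        by (rule far) (use t in \<open>auto simp: abs_if split: if_splits\<close>)
      moreover have "(real n + 1 / 2)\<^sup>2 + (real m)\<^sup>2 = of_int (int (n\<^sup>2 + n + m\<^sup>2)) + 1 / 4"
        by (simp add: power2_eq_square algebra_simps)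
      moreover have "mu B1 B3 k n = (real n + 1 / 2) * pi"
        using True t unfolding mu_def d1 by simp
      ultimately show ?thesis
        using True shift[of "real n + 1 / 2" "real m" "int (n\<^sup>2 + n + m\<^sup>2)" "1 / 4"] by simp
    next
      case t': False
      have "1 / 8 \<le> \<bar>of_int q + t - 0\<bar>" for q
        by (rule far) (use t t' in \<open>auto simp: abs_if split: if_splits\<close>)
      moreover have "(real n)\<^sup>2 + (real m)\<^sup>2 = of_int (int (n\<^sup>2 + m\<^sup>2)) + 0"
        by simp
      moreover have "mu B1 B3 k n = (real n) * pi"
        using True t' unfolding mu_def d1 by simp
      ultimately show ?thesis
        using True shift[of "real n" "real m" "int (n\<^sup>2 + m\<^sup>2)" "0"] by simp
    qed
  next
    case False
    show ?thesis
    proof (cases "\<bar>t\<bar> \<le> 1 / 8 \<or> 3 / 8 \<le> \<bar>t\<bar>")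
      case t': True
      have "1 / 8 \<le> \<bar>of_int q + t - 1 / 4\<bar>" for q
        by (rule far) (use t t' in \<open>auto simp: abs_if split: if_splits\<close>)
      moreover have "(real n)\<^sup>2 + (real m + 1 / 2)\<^sup>2 = of_int (int (n\<^sup>2 + m\<^sup>2 + m)) + 1 / 4"
        by (simp add: power2_eq_square algebra_simps)
      moreover have "mu B1 B3 k n = (real n) * pi"
        using False t' unfolding mu_def d1 d2 Un_iff by simp
      ultimately show ?thesis
        using False shift[of "real n" "real m + 1 / 2" "int (n\<^sup>2 + m\<^sup>2 + m)" "1 / 4"] by simp
    next
      case t': False
      have "1 / 8 \<le> \<bar>of_int q + t - 1 / 2\<bar>" for q
        by (rule far) (use t t' in \<open>auto simp: abs_if split: if_splits\<close>)
      moreover have "(real n + 1 / 2)\<^sup>2 + (real m + 1 / 2)\<^sup>2 = of_int (int (n\<^sup>2 + n + m\<^sup>2 + m)) + 1 / 2"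
        by (simp add: power2_eq_square algebra_simps)
      moreover have "mu B1 B3 k n = (real n + 1 / 2) * pi"
        using False t' unfolding mu_def d1 d2 Un_iff by simp
      ultimately show ?thesis
        using False shift[of "real n + 1 / 2" "real m + 1 / 2" "int (n\<^sup>2 + n + m\<^sup>2 + m)" "1 / 2"] by simp
    qed
  qed
qed

section \<open>Bounds for a single mode\<close>

text \<open>One of b and c vanishes, and the condition at y = 0 gives the other with sin \<kappa> or
  cos \<kappa> in the denominator, whose reciprocal is at most M. Under a Neumann condition at y = 0
  a factor 1 / \<kappa> or |S| offsets the growth of M, so the solution stays bounded in \<kappa>;
  under a Dirichlet condition no such gain occurs, which is the source of max (k^2) 1 in the second
  estimate.\<close>

lemma sol_bounds_osc:
  assumes \<kappa>: "\<kappa> \<ge> 0" and y: "y \<in> {0..1}"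
    and res: "\<And>m::nat. pi\<^sup>2 / 8 \<le> \<bar>\<kappa>\<^sup>2 - ((if B1 = B3 then real m else real m + 1 / 2) * pi)\<^sup>2\<bar>"
    and b1: "bdry_op B1 (-1) (sol (\<kappa>\<^sup>2) b c) (sol' (\<kappa>\<^sup>2) b c) 0 = 1"
    and b3: "bdry_op B3 1 (sol (\<kappa>\<^sup>2) b c) (sol' (\<kappa>\<^sup>2) b c) 1 = 0"
  defines "M \<equiv> 14 / 3 * max 1 \<kappa>"
  shows "B1 = Neumann \<Longrightarrow> \<bar>sol (\<kappa>\<^sup>2) b c y\<bar> \<le> 14 / 3 \<and> \<bar>sol' (\<kappa>\<^sup>2) b c y\<bar> \<le> M"
    and "B1 = Dirichlet \<Longrightarrow> \<bar>sol (\<kappa>\<^sup>2) b c y\<bar> \<le> M \<and> \<bar>sol' (\<kappa>\<^sup>2) b c y\<bar> \<le> \<kappa> * M"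
proof -
  define C where "C = cosl (\<kappa>\<^sup>2) (1 - y)"
  define S where "S = sinl (\<kappa>\<^sup>2) (1 - y)"
  define s where "s = sinl (\<kappa>\<^sup>2) 1"
  have M: "M \<ge> 14 / 3" "M \<ge> 14 / 3 * \<kappa>" by (auto simp: M_def)
  have bounds: "\<bar>C\<bar> \<le> 1" "\<bar>S\<bar> \<le> 1" "\<kappa> * \<bar>S\<bar> \<le> 1" and s: "\<kappa> * s = sin \<kappa>" and C1: "cosl (\<kappa>\<^sup>2) 1 = cos \<kappa>"
    using cosl_sinl_osc[of "\<kappa>\<^sup>2" "1 - y"] \<kappa> y by (auto simp: C_def S_def s_def)
  have V: "sol (\<kappa>\<^sup>2) b c y = b * C - c * S" "sol' (\<kappa>\<^sup>2) b c y = \<kappa> * (b * (\<kappa> * S)) + c * C"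
    by (simp_all add: sol_def sol'_def C_def S_def) (simp add: power2_eq_square)
  have V0: "sol (\<kappa>\<^sup>2) b c 0 = b * cos \<kappa> - c * s" "sol' (\<kappa>\<^sup>2) b c 0 = \<kappa> * b * sin \<kappa> + c * cos \<kappa>"
    unfolding s[symmetric] sol_def sol'_def by (simp_all add: C1 flip: s_def) (simp add: power2_eq_square)
  have same: "1 \<le> M * \<bar>sin \<kappa>\<bar>" "1 \<le> \<kappa>" if "B1 = B3"
  proof -
    show "1 \<le> M * \<bar>sin \<kappa>\<bar>"
      unfolding M_def using res that by (intro abs_sin_lower_bound \<kappa>) auto
    \<comment> \<open>The instance m = 0 of nonresonance reads \<kappa>^2 \<ge> pi^2 / 8, which
      exceeds 1.\<close>
    have "3 \<le> pi" using pi_approx by simp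
    then have "9 / 8 \<le> pi\<^sup>2 / 8" using power_mono[of 3 pi 2] by simp
    also have "\<dots> \<le> \<kappa>\<^sup>2" using res[of 0] that by simp
    finally have "1\<^sup>2 \<le> \<kappa>\<^sup>2" by simp
    then show "1 \<le> \<kappa>" using \<kappa> by (rule power2_le_imp_le)
  qed
  have diff: "1 \<le> M * \<bar>cos \<kappa>\<bar>" if "B1 \<noteq> B3"
    unfolding M_def using res that by (intro abs_cos_lower_bound \<kappa>) auto
  \<comment> \<open>The bounds |S| \<le> 1 and \<kappa> |S| \<le> 1 together cancel the factor max 1
    \<kappa> in M.\<close>
  have MS: "M * \<bar>S\<bar> \<le> 14 / 3"
    using bounds by (auto simp: M_def max_def mult.commute)
  {
    assume B1: "B1 = Neumann"
    show "\<bar>sol (\<kappa>\<^sup>2) b c y\<bar> \<le> 14 / 3 \<and> \<bar>sol' (\<kappa>\<^sup>2) b c y\<bar> \<le> M"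
    proof (cases B3)
      case Neumann
      then have c: "c = 0" and b: "\<kappa> * b * sin \<kappa> = - 1" and k1: "1 \<le> \<kappa>"
        using b1 b3 V0 B1 same by auto
      have b: "\<kappa> * \<bar>b\<bar> * \<bar>sin \<kappa>\<bar> = 1"
        using arg_cong[OF b, of abs] \<kappa> by (simp add: abs_mult)
      have "1 * (\<kappa> * \<bar>b\<bar>) \<le> M * \<bar>sin \<kappa>\<bar> * (\<kappa> * \<bar>b\<bar>)"
        using same Neumann B1 \<kappa> by (intro mult_right_mono) auto
      also have "\<dots> = \<kappa> * (14 / 3)"
        using k1 b by (simp add: M_def mult_ac)
      finally have b: "\<bar>b\<bar> \<le> 14 / 3" using k1 by simp
      have "\<bar>b\<bar> * \<bar>C\<bar> \<le> 14 / 3 * 1"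
        using b bounds by (intro mult_mono) auto
      moreover have "\<bar>b\<bar> * \<kappa> * (\<kappa> * \<bar>S\<bar>) \<le> 14 / 3 * \<kappa> * 1"
        using b bounds \<kappa> by (intro mult_mono) auto
      ultimately show ?thesis
        unfolding V using M(2) \<kappa> by (simp add: c abs_mult mult_ac)
    next
      case Dirichlet
      then have b: "b = 0" and c: "c * cos \<kappa> = - 1"
        using b1 b3 V0 B1 by auto
      have c: "\<bar>c\<bar> * \<bar>cos \<kappa>\<bar> = 1"
        using arg_cong[OF c, of abs] by (simp add: abs_mult)
      have "1 * \<bar>c\<bar> \<le> M * \<bar>cos \<kappa>\<bar> * \<bar>c\<bar>"
        using diff Dirichlet B1 by (intro mult_right_mono) auto
      then have c: "\<bar>c\<bar> \<le> M" using c by (simp add: mult_ac)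
      have "\<bar>c\<bar> * \<bar>S\<bar> \<le> M * \<bar>S\<bar>" "\<bar>c\<bar> * \<bar>C\<bar> \<le> M * 1"
        using c bounds M by (intro mult_mono; simp)+
      then show ?thesis
        unfolding V using MS by (simp add: b abs_mult)
    qed
  next
    assume B1: "B1 = Dirichlet"
    show "\<bar>sol (\<kappa>\<^sup>2) b c y\<bar> \<le> M \<and> \<bar>sol' (\<kappa>\<^sup>2) b c y\<bar> \<le> \<kappa> * M"
    proof (cases B3)
      case Neumann
      then have c: "c = 0" and b: "b * cos \<kappa> = 1"
        using b1 b3 V0 B1 by auto
      have b: "\<bar>b\<bar> * \<bar>cos \<kappa>\<bar> = 1"
        using arg_cong[OF b, of abs] by (simp add: abs_mult)
      have "1 * \<bar>b\<bar> \<le> M * \<bar>cos \<kappa>\<bar> * \<bar>b\<bar>"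
        using diff Neumann B1 by (intro mult_right_mono) auto
      then have b: "\<bar>b\<bar> \<le> M" using b by (simp add: mult_ac)
      have "\<bar>b\<bar> * \<bar>C\<bar> \<le> M * 1" "(\<bar>b\<bar> * \<kappa>) * (\<kappa> * \<bar>S\<bar>) \<le> (M * \<kappa>) * 1"
        using b bounds M \<kappa> by (intro mult_mono; simp)+
      then show ?thesis
        unfolding V using \<kappa> by (simp add: c abs_mult mult_ac)
    next
      case Dirichlet
      then have b: "b = 0" and c: "c * s = - 1" and k1: "1 \<le> \<kappa>"
        using b1 b3 V0 B1 same by auto
      \<comment> \<open>Because \<kappa> s = sin \<kappa>, c is - \<kappa> / sin \<kappa>. The extra
        \<kappa> is absorbed by \<kappa> |S| \<le> 1 in the value and remains in the
        derivative.\<close>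
      have c: "\<bar>c\<bar> * \<bar>sin \<kappa>\<bar> = \<kappa>"
        using arg_cong[OF c, of abs] \<kappa> by (simp add: abs_mult flip: s)
      have "1 * \<bar>c\<bar> \<le> M * \<bar>sin \<kappa>\<bar> * \<bar>c\<bar>"
        using same Dirichlet B1 by (intro mult_right_mono) auto
      then have c: "\<bar>c\<bar> \<le> \<kappa> * M" using c by (simp add: mult_ac)
      have "\<bar>c\<bar> * \<bar>S\<bar> \<le> \<kappa> * M * \<bar>S\<bar>" "\<bar>c\<bar> * \<bar>C\<bar> \<le> \<kappa> * M * 1" "M * (\<kappa> * \<bar>S\<bar>) \<le> M * 1"
        using c bounds M \<kappa> by (intro mult_mono; simp)+
      then show ?thesis
        unfolding V by (simp add: b abs_mult mult_ac)
    qed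
  }
qed

text \<open>The bound on \<open>- sol' 0\<close> is a bound for the energy \<open>\<integral> (sol')\<^sup>2 + \<kappa>\<^sup>2 sol\<^sup>2\<close>, because
  \<open>(sol')\<^sup>2 + \<kappa>\<^sup>2 sol\<^sup>2\<close> is the derivative of \<open>sol * sol'\<close>.\<close>

lemma sol_bounds_hyp:
  assumes \<kappa>: "\<kappa> > 0" and y: "y \<in> {0..1}"
    and large: "B1 = B3 \<Longrightarrow> 1 \<le> \<kappa>"
    and b1: "bdry_op B1 (-1) (sol (- \<kappa>\<^sup>2) b c) (sol' (- \<kappa>\<^sup>2) b c) 0 = 1"
    and b3: "bdry_op B3 1 (sol (- \<kappa>\<^sup>2) b c) (sol' (- \<kappa>\<^sup>2) b c) 1 = 0"
  shows "B1 = Neumann \<Longrightarrow> \<bar>sol (- \<kappa>\<^sup>2) b c y\<bar> \<le> 2 \<and> \<kappa> * \<bar>sol (- \<kappa>\<^sup>2) b c y\<bar> \<le> 2 \<and> \<bar>sol' (- \<kappa>\<^sup>2) b c y\<bar> \<le> 1"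
    and "B1 = Dirichlet \<Longrightarrow> \<bar>sol (- \<kappa>\<^sup>2) b c y\<bar> \<le> 1 \<and> - sol' (- \<kappa>\<^sup>2) b c 0 \<le> 2 * \<kappa>"
proof -
  let ?l = "- \<kappa>\<^sup>2"
  define C where "C = cosl ?l (1 - y)"
  define S where "S = sinl ?l (1 - y)"
  define s where "s = sinl ?l 1"
  have bounds: "\<bar>C\<bar> \<le> cosh \<kappa>" "\<kappa> * \<bar>S\<bar> \<le> sinh \<kappa>" "\<bar>S\<bar> \<le> cosh \<kappa>" and s: "\<kappa> * s = sinh \<kappa>" and C1: "cosl ?l 1 = cosh \<kappa>"
    using cosl_sinl_hyp[of \<kappa> "1 - y"] \<kappa> y by (auto simp: C_def S_def s_def)
  have V: "sol ?l b c y = b * C - c * S" "sol' ?l b c y = - (\<kappa> * (b * (\<kappa> * S))) + c * C"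
    by (simp_all add: sol_def sol'_def C_def S_def) (simp add: power2_eq_square)
  have V0: "sol ?l b c 0 = b * cosh \<kappa> - c * s" "sol' ?l b c 0 = - (\<kappa> * b * sinh \<kappa>) + c * cosh \<kappa>"
    unfolding s[symmetric] sol_def sol'_def by (simp_all add: C1 flip: s_def) (simp add: power2_eq_square)
  have sc: "sinh \<kappa> \<le> cosh \<kappa>" "sinh \<kappa> > 0" "cosh \<kappa> > 0"
    using \<kappa> by (auto simp: sinh_le_cosh_real)
  {
    assume B1: "B1 = Neumann"
    show "\<bar>sol ?l b c y\<bar> \<le> 2 \<and> \<kappa> * \<bar>sol ?l b c y\<bar> \<le> 2 \<and> \<bar>sol' ?l b c y\<bar> \<le> 1"
    proof (cases B3)
      case Neumann
      then have c: "c = 0" and b: "\<kappa> * b * sinh \<kappa> = 1" and k1: "1 \<le> \<kappa>"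
        using b1 b3 V0 B1 large by auto
      have b: "\<kappa> * \<bar>b\<bar> * sinh \<kappa> = 1"
        using arg_cong[OF b, of abs] \<kappa> by (simp add: abs_mult)
      \<comment> \<open>As |b| = 1 / (\<kappa> sinh \<kappa>), the quantity is at most coth
        \<kappa>, hence at most 2.\<close>
      have "\<kappa> * \<bar>b\<bar> * \<bar>C\<bar> \<le> \<kappa> * \<bar>b\<bar> * (2 * sinh \<kappa>)"
        using bounds cosh_le_2_sinh[OF k1] \<kappa> by (intro mult_left_mono) auto
      also have "\<dots> = 2" using b by simp
      finally have kV: "\<kappa> * (\<bar>b\<bar> * \<bar>C\<bar>) \<le> 2" by (simp add: mult.assoc)
      moreover have "1 * (\<bar>b\<bar> * \<bar>C\<bar>) \<le> \<kappa> * (\<bar>b\<bar> * \<bar>C\<bar>)"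
        using k1 by (intro mult_right_mono) auto
      moreover have "\<kappa> * \<bar>b\<bar> * (\<kappa> * \<bar>S\<bar>) \<le> 1"
        unfolding b[symmetric] using bounds \<kappa> by (intro mult_left_mono) auto
      ultimately show ?thesis
        unfolding V using \<kappa> by (simp add: c abs_mult mult_ac)
    next
      case Dirichlet
      then have b: "b = 0" and c: "c * cosh \<kappa> = - 1"
        using b1 b3 V0 B1 by auto
      have c: "\<bar>c\<bar> * cosh \<kappa> = 1"
        using arg_cong[OF c, of abs] by (simp add: abs_mult)
      have "\<bar>c\<bar> * \<bar>S\<bar> \<le> \<bar>c\<bar> * cosh \<kappa>" "\<bar>c\<bar> * (\<kappa> * \<bar>S\<bar>) \<le> \<bar>c\<bar> * cosh \<kappa>" "\<bar>c\<bar> * \<bar>C\<bar> \<le> \<bar>c\<bar> * cosh \<kappa>"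
        using bounds sc by (intro mult_left_mono; simp)+
      then show ?thesis
        unfolding V using c by (simp add: b abs_mult mult_ac)
    qed
  next
    assume B1: "B1 = Dirichlet"
    show "\<bar>sol ?l b c y\<bar> \<le> 1 \<and> - sol' ?l b c 0 \<le> 2 * \<kappa>"
    proof (cases B3)
      case Neumann
      then have c: "c = 0" and b: "b * cosh \<kappa> = 1"
        using b1 b3 V0 B1 by auto
      then have "0 < b * cosh \<kappa>" by simp
      then have b0: "b > 0" using sc by (simp only: zero_less_mult_iff) linarith
      have "b * \<bar>C\<bar> \<le> b * cosh \<kappa>" "b * sinh \<kappa> \<le> b * cosh \<kappa>"
        using bounds sc b0 by (intro mult_left_mono; simp)+
      moreover from this have "\<kappa> * (b * sinh \<kappa>) \<le> \<kappa> * 1"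
        using b \<kappa> by (intro mult_left_mono) auto
      ultimately show ?thesis
        unfolding V V0 using b b0 \<kappa> by (simp add: c abs_mult mult_ac)
    next
      case Dirichlet
      then have b: "b = 0" and cs: "c * s = - 1" and k1: "1 \<le> \<kappa>"
        using b1 b3 V0 B1 large by auto
      have cs: "c * sinh \<kappa> = - \<kappa>"
        using arg_cong[OF cs, of "(*) \<kappa>"] by (simp add: mult.left_commute flip: s)
      then have "c * sinh \<kappa> < 0" using \<kappa> by simp
      then have c0: "c < 0" using sc by (simp only: mult_less_0_iff) linarith
      \<comment> \<open>Here - c = \<kappa> / sinh \<kappa>, so - \<open>sol'\<close> at 0 equals
        \<kappa> coth \<kappa>; in the value the same coefficient is compensated by \<kappa> |S|
        \<le> sinh \<kappa>.\<close>
      have 1: "(- c) * (\<kappa> * \<bar>S\<bar>) \<le> (- c) * sinh \<kappa>" and 2: "(- c) * cosh \<kappa> \<le> (- c) * (2 * sinh \<kappa>)"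
        using bounds c0 cosh_le_2_sinh[OF k1] by (intro mult_left_mono; simp)+
      have "\<kappa> * (\<bar>c\<bar> * \<bar>S\<bar>) \<le> \<kappa> * 1"
        using 1 cs c0 by (simp add: mult.left_commute)
      moreover have "- (c * cosh \<kappa>) \<le> 2 * \<kappa>"
        using 2 cs by linarith
      ultimately show ?thesis
        unfolding V V0 using \<kappa> by (simp add: b abs_mult)
    qed
  }
qed

lemma integral_unit_interval_le:
  fixes f :: "real \<Rightarrow> real"
  assumes "continuous_on {0..1} f" "\<And>y. y \<in> {0..1} \<Longrightarrow> f y \<le> c"
  shows "integral {0..1} f \<le> c"
proof -
  have "integral {0..1} f \<le> integral {0..1} (\<lambda>_::real. c)"
    using assms by (intro integral_le integrable_continuous_interval) auto
  then show ?thesis by simp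
qed

text \<open>The term b * c comes from y = 1 and vanishes under either condition there.\<close>

lemma sol_energy:
  "integral {0..1} (\<lambda>y. (sol' (- \<kappa>\<^sup>2) b c y)\<^sup>2 + \<kappa>\<^sup>2 * (sol (- \<kappa>\<^sup>2) b c y)\<^sup>2) =
    b * c - sol (- \<kappa>\<^sup>2) b c 0 * sol' (- \<kappa>\<^sup>2) b c 0"
proof (rule integral_unique)
  let ?l = "- \<kappa>\<^sup>2"
  have "((\<lambda>y. sol ?l b c y * sol' ?l b c y) has_real_derivative
      (sol' ?l b c y)\<^sup>2 + \<kappa>\<^sup>2 * (sol ?l b c y)\<^sup>2) (at y)" for y
    by (rule DERIV_cong[OF DERIV_mult[OF sol_has_derivative sol'_has_derivative]])
      (simp add: power2_eq_square algebra_simps)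
  then have "((\<lambda>y. (sol' ?l b c y)\<^sup>2 + \<kappa>\<^sup>2 * (sol ?l b c y)\<^sup>2) has_integral
      sol ?l b c 1 * sol' ?l b c 1 - sol ?l b c 0 * sol' ?l b c 0) {0..1}"
    by (intro fundamental_theorem_of_calculus)
      (auto simp flip: has_real_derivative_iff_has_vector_derivative intro: has_field_derivative_at_within)
  then show "((\<lambda>y. (sol' ?l b c y)\<^sup>2 + \<kappa>\<^sup>2 * (sol ?l b c y)\<^sup>2) has_integral
      b * c - sol ?l b c 0 * sol' ?l b c 0) {0..1}"
    by simp
qed

text \<open>The form is A + B m: the part A is summed by Bessel's inequality and the part B m
  against the weight of Z^(1/2). Squared norms are bounded, hence the squares. The oscillatory modes
  need 2 * 196/9 in the Neumann and 196/9 in the Dirichlet case, which 717 and 43 exceed.\<close>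

definition mode_bound :: "bc \<Rightarrow> real \<Rightarrow> real \<Rightarrow> real" where
  "mode_bound B1 k m = (case B1 of Neumann \<Rightarrow> 717 * (max k 1)\<^sup>2
     | Dirichlet \<Rightarrow> 43 * (max (k\<^sup>2) 1)\<^sup>2 + 43 * max k 1 * m)"

text \<open>As \<open>Y\<close> is constrained on [0, 1] only, the bounds are stated for a function
  V that agrees with it there and is differentiable on the whole line.\<close>

lemma mode_estimate:
  assumes k: "k > 0" and \<mu>: "\<mu> \<ge> 0" and Y: "is_Y_solution B1 B3 k \<mu> Y"
    and res: "\<And>m::nat. pi\<^sup>2 / 8 \<le> \<bar>k\<^sup>2 - \<mu>\<^sup>2 - ((if B1 = B3 then real m else real m + 1 / 2) * pi)\<^sup>2\<bar>"
  obtains V V' where "\<And>y. y \<in> {0..1} \<Longrightarrow> Y y = V y"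
    "\<And>y. (V has_real_derivative V' y) (at y)" "continuous_on UNIV V'"
    "\<mu>\<^sup>2 * integral {0..1} (\<lambda>y. (V y)\<^sup>2) + integral {0..1} (\<lambda>y. (V' y)\<^sup>2) \<le> mode_bound B1 k \<mu>"
    "k\<^sup>2 * integral {0..1} (\<lambda>y. (V y)\<^sup>2) \<le> mode_bound B1 k \<mu>"
proof -
  define l where "l = k\<^sup>2 - \<mu>\<^sup>2"
  define K where "K = max k 1"
  obtain b c where Yeq: "\<And>y. y \<in> {0..1} \<Longrightarrow> Y y = sol l b c y"
    and b1: "bdry_op B1 (-1) (sol l b c) (sol' l b c) 0 = 1"
    and b3: "bdry_op B3 1 (sol l b c) (sol' l b c) 1 = 0"
    using is_Y_solution_eq_sol[OF Y] unfolding l_def by blast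
  let ?V = "sol l b c" and ?V' = "sol' l b c"
  have K: "K \<ge> 1" "K \<ge> k" by (auto simp: K_def)
  have K2: "(max (k\<^sup>2) 1)\<^sup>2 = K\<^sup>2 * K\<^sup>2"
    using k power_mono[of k 1 2] one_le_power[of k 2] by (auto simp: K_def max_def power2_eq_square)
  have kK: "k\<^sup>2 \<le> K\<^sup>2" "1 \<le> K\<^sup>2"
    using K k by (auto intro: power_mono)
  then have kKK: "k\<^sup>2 * K\<^sup>2 \<le> K\<^sup>2 * K\<^sup>2" "k\<^sup>2 \<le> K\<^sup>2 * K\<^sup>2"
    using mult_right_mono[of "k\<^sup>2" "K\<^sup>2" "K\<^sup>2"] mult_mono[of "k\<^sup>2" "K\<^sup>2" 1 "K\<^sup>2"] by auto
  have bound: "mode_bound B1 k \<mu> = (case B1 of Neumann \<Rightarrow> 717 * K\<^sup>2 | Dirichlet \<Rightarrow> 43 * (K\<^sup>2 * K\<^sup>2) + 43 * K * \<mu>)"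
    unfolding mode_bound_def K2 unfolding K_def ..
  have K\<mu>: "\<mu> \<le> K * \<mu>" using K \<mu> mult_right_mono[of 1 K \<mu>] by simp
  have int: "?V integrable_on {0..1}" "(\<lambda>y. (?V y)\<^sup>2) integrable_on {0..1}" "(\<lambda>y. (?V' y)\<^sup>2) integrable_on {0..1}"
    by (intro integrable_continuous_interval continuous_intros continuous_on_sol)+
  have E: "r * integral {0..1} (\<lambda>y. (?V y)\<^sup>2) + integral {0..1} (\<lambda>y. (?V' y)\<^sup>2) =
      integral {0..1} (\<lambda>y. (?V' y)\<^sup>2 + r * (?V y)\<^sup>2)" for r
    using int by (subst integral_add) (auto intro: integrable_on_mult_right)
  note result = that
  \<comment> \<open>This serves every case except the hyperbolic one with a Dirichlet condition at y
    = 0, where the derivative is controlled only in the mean.\<close>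
  have pointwise: ?thesis
    if "\<And>y. y \<in> {0..1} \<Longrightarrow> (?V' y)\<^sup>2 + \<mu>\<^sup>2 * (?V y)\<^sup>2 \<le> mode_bound B1 k \<mu>"
      "\<And>y. y \<in> {0..1} \<Longrightarrow> k\<^sup>2 * (?V y)\<^sup>2 \<le> mode_bound B1 k \<mu>"
  proof (rule result[OF Yeq sol_has_derivative continuous_on_sol(2)])
    show "\<mu>\<^sup>2 * integral {0..1} (\<lambda>y. (?V y)\<^sup>2) + integral {0..1} (\<lambda>y. (?V' y)\<^sup>2) \<le> mode_bound B1 k \<mu>"
      unfolding E using that by (intro integral_unit_interval_le continuous_intros continuous_on_sol)
    have "k\<^sup>2 * integral {0..1} (\<lambda>y. (?V y)\<^sup>2) = integral {0..1} (\<lambda>y. k\<^sup>2 * (?V y)\<^sup>2)"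
      by simp
    also have "\<dots> \<le> mode_bound B1 k \<mu>"
      using that by (intro integral_unit_interval_le continuous_intros continuous_on_sol)
    finally show "k\<^sup>2 * integral {0..1} (\<lambda>y. (?V y)\<^sup>2) \<le> mode_bound B1 k \<mu>" .
  qed auto
  show ?thesis
  proof (cases "l \<ge> 0")
    case True
    define \<kappa> where "\<kappa> = sqrt l"
    have \<kappa>: "\<kappa> \<ge> 0" "\<kappa>\<^sup>2 = l" using True by (auto simp: \<kappa>_def)
    have \<kappa>k: "\<kappa> \<le> k" "\<mu>\<^sup>2 \<le> k\<^sup>2" using \<kappa> True k by (auto simp: l_def intro: power2_le_imp_le)
    define M where "M = 14 / 3 * max 1 \<kappa>"
    have M: "M \<le> 14 / 3 * K" "M \<ge> 0" using \<kappa>k K by (auto simp: M_def)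
    have M2: "M\<^sup>2 \<le> 196 / 9 * K\<^sup>2"
      using power_mono[OF M, of 2] by (simp add: power_mult_distrib power_divide)
    note B = sol_bounds_osc[OF \<kappa>(1), where ?B1.0 = B1 and ?B3.0 = B3 and b = b and c = c, unfolded \<kappa>(2), folded M_def]
    have res': "pi\<^sup>2 / 8 \<le> \<bar>l - ((if B1 = B3 then real m else real m + 1 / 2) * pi)\<^sup>2\<bar>" for m :: nat
      using res by (simp add: l_def)
    show ?thesis
    proof (cases B1)
      case Neumann
      show ?thesis
      proof (rule pointwise)
        fix y :: real assume y: "y \<in> {0..1}"
        have v: "(?V y)\<^sup>2 \<le> 196 / 9"
          using B(1)[OF y res' b1 b3 Neumann] power_mono[of "\<bar>?V y\<bar>" "14 / 3" 2] by (simp add: power_divide)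
        have "(?V' y)\<^sup>2 \<le> M\<^sup>2"
          using B(1)[OF y res' b1 b3 Neumann] power_mono[of "\<bar>?V' y\<bar>" M 2] by simp
        moreover have "\<mu>\<^sup>2 * (?V y)\<^sup>2 \<le> K\<^sup>2 * (196 / 9)" "k\<^sup>2 * (?V y)\<^sup>2 \<le> K\<^sup>2 * (196 / 9)"
          using v \<kappa>k kK by (intro mult_mono; simp)+
        ultimately show "(?V' y)\<^sup>2 + \<mu>\<^sup>2 * (?V y)\<^sup>2 \<le> mode_bound B1 k \<mu>" "k\<^sup>2 * (?V y)\<^sup>2 \<le> mode_bound B1 k \<mu>"
          unfolding bound using M2 kK(2) by (simp_all add: Neumann)
      qed
    next
      case Dirichlet
      show ?thesis
      proof (rule pointwise)
        fix y :: real assume y: "y \<in> {0..1}"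
        have v: "(?V y)\<^sup>2 \<le> M\<^sup>2"
          using B(2)[OF y res' b1 b3 Dirichlet] power_mono[of "\<bar>?V y\<bar>" M 2] by simp
        have v': "(?V' y)\<^sup>2 \<le> l * M\<^sup>2"
          using B(2)[OF y res' b1 b3 Dirichlet] power_mono[of "\<bar>?V' y\<bar>" "\<kappa> * M" 2]
          by (simp add: power_mult_distrib \<kappa>)
        have "k\<^sup>2 * M\<^sup>2 \<le> k\<^sup>2 * (196 / 9 * K\<^sup>2)"
          using M2 by (intro mult_left_mono) auto
        also have "\<dots> = 196 / 9 * (k\<^sup>2 * K\<^sup>2)" by simp
        also have "\<dots> \<le> 43 * (K\<^sup>2 * K\<^sup>2)"
          using kKK(1) zero_le_square[of "K\<^sup>2"] by linarith
        finally have kM: "k\<^sup>2 * M\<^sup>2 \<le> 43 * (K\<^sup>2 * K\<^sup>2)" .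
        have "(?V' y)\<^sup>2 + \<mu>\<^sup>2 * (?V y)\<^sup>2 \<le> l * M\<^sup>2 + \<mu>\<^sup>2 * M\<^sup>2"
          using v v' by (intro add_mono mult_left_mono) auto
        \<comment> \<open>The two factors recombine because l + \<mu>^2 = k^2; with M of order K the
          total is of order K^4.\<close>
        also have "\<dots> = k\<^sup>2 * M\<^sup>2" by (simp add: l_def algebra_simps)
        finally show "(?V' y)\<^sup>2 + \<mu>\<^sup>2 * (?V y)\<^sup>2 \<le> mode_bound B1 k \<mu>"
          unfolding bound using kM K\<mu> \<mu> by (simp add: Dirichlet)
        have "k\<^sup>2 * (?V y)\<^sup>2 \<le> k\<^sup>2 * M\<^sup>2"
          using v by (intro mult_left_mono) auto
        then show "k\<^sup>2 * (?V y)\<^sup>2 \<le> mode_bound B1 k \<mu>"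
          unfolding bound using kM K\<mu> \<mu> by (simp add: Dirichlet)
      qed
    qed
  next
    case False
    define \<kappa> where "\<kappa> = sqrt (- l)"
    have \<kappa>: "\<kappa> > 0" "- \<kappa>\<^sup>2 = l" using False by (auto simp: \<kappa>_def)
    have \<mu>2: "\<mu>\<^sup>2 = k\<^sup>2 + \<kappa>\<^sup>2" using \<kappa>(2) by (simp add: l_def)
    have \<kappa>\<mu>: "\<kappa> \<le> \<mu>" by (rule power2_le_imp_le) (use \<mu>2 \<mu> in auto)
    have large: "1 \<le> \<kappa>" if "B1 = B3"
    proof -
      have "3 \<le> pi" using pi_approx by simp
      then have "9 / 8 \<le> pi\<^sup>2 / 8" using power_mono[of 3 pi 2] by simp
      also have "\<dots> \<le> \<kappa>\<^sup>2" using res[of 0] that \<mu>2 by simp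
      finally have "1\<^sup>2 \<le> \<kappa>\<^sup>2" by simp
      then show "1 \<le> \<kappa>" by (rule power2_le_imp_le) (use \<kappa> in auto)
    qed
    note B = sol_bounds_hyp[OF \<kappa>(1), where ?B1.0 = B1 and ?B3.0 = B3 and b = b and c = c, unfolded \<kappa>(2)]
    show ?thesis
    proof (cases B1)
      case Neumann
      show ?thesis
      proof (rule pointwise)
        fix y :: real assume y: "y \<in> {0..1}"
        note By = B(1)[OF y large b1 b3 Neumann]
        have v: "(?V y)\<^sup>2 \<le> 4"
          using By power_mono[of "\<bar>?V y\<bar>" 2 2] by simp
        have v': "(?V' y)\<^sup>2 \<le> 1"
          using By power_mono[of "\<bar>?V' y\<bar>" 1 2] by simp
        have kv: "\<kappa>\<^sup>2 * (?V y)\<^sup>2 \<le> 4"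
          using By power_mono[of "\<kappa> * \<bar>?V y\<bar>" 2 2] \<kappa> by (simp add: power_mult_distrib)
        have "k\<^sup>2 * (?V y)\<^sup>2 \<le> K\<^sup>2 * 4"
          using v kK by (intro mult_mono) auto
        then show "(?V' y)\<^sup>2 + \<mu>\<^sup>2 * (?V y)\<^sup>2 \<le> mode_bound B1 k \<mu>" "k\<^sup>2 * (?V y)\<^sup>2 \<le> mode_bound B1 k \<mu>"
          unfolding bound using v' kv kK by (simp_all add: Neumann \<mu>2 distrib_right)
      qed
    next
      case Dirichlet
      have v: "k\<^sup>2 * integral {0..1} (\<lambda>y. (?V y)\<^sup>2) \<le> k\<^sup>2 * 1"
      proof (intro mult_left_mono integral_unit_interval_le continuous_intros continuous_on_sol)
        fix y :: real assume y: "y \<in> {0..1}"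
        show "(?V y)\<^sup>2 \<le> 1"
          using B(2)[OF y large b1 b3 Dirichlet] power_mono[of "\<bar>?V y\<bar>" 1 2] by simp
      qed auto
      have "b * c = 0" "?V 0 = 1"
        using b1 b3 Dirichlet by (cases B3; auto)+
      then have "\<kappa>\<^sup>2 * integral {0..1} (\<lambda>y. (?V y)\<^sup>2) + integral {0..1} (\<lambda>y. (?V' y)\<^sup>2) = - ?V' 0"
        unfolding E using sol_energy[of \<kappa> b c] by (simp add: \<kappa>(2))
      also have "\<dots> \<le> 2 * \<mu>"
        using B(2)[of 0, OF _ large b1 b3 Dirichlet] \<kappa>\<mu> by simp
      finally have e: "\<kappa>\<^sup>2 * integral {0..1} (\<lambda>y. (?V y)\<^sup>2) + integral {0..1} (\<lambda>y. (?V' y)\<^sup>2) \<le> 2 * \<mu>" .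
      \<comment> \<open>In \<mu>^2 = k^2 + \<kappa>^2 the part \<kappa>^2 belongs to the energy, at
        most 2 \<mu>, and the part k^2 contributes at most k^2 because |V| \<le> 1.\<close>
      have sum: "k\<^sup>2 * integral {0..1} (\<lambda>y. (?V y)\<^sup>2) + \<kappa>\<^sup>2 * integral {0..1} (\<lambda>y. (?V y)\<^sup>2)
          + integral {0..1} (\<lambda>y. (?V' y)\<^sup>2) \<le> 43 * (K\<^sup>2 * K\<^sup>2) + 43 * K * \<mu>"
        using e v kKK K\<mu> \<mu> zero_le_square[of "K\<^sup>2"] by linarith
      have sum2: "k\<^sup>2 * integral {0..1} (\<lambda>y. (?V y)\<^sup>2) \<le> 43 * (K\<^sup>2 * K\<^sup>2) + 43 * K * \<mu>"
        using v kKK K\<mu> \<mu> zero_le_square[of "K\<^sup>2"] by linarith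
      show ?thesis
      proof (rule result[OF Yeq sol_has_derivative continuous_on_sol(2)])
        show "\<mu>\<^sup>2 * integral {0..1} (\<lambda>y. (?V y)\<^sup>2) + integral {0..1} (\<lambda>y. (?V' y)\<^sup>2) \<le> mode_bound B1 k \<mu>"
          unfolding bound using sum by (simp add: Dirichlet \<mu>2 distrib_right)
        show "k\<^sup>2 * integral {0..1} (\<lambda>y. (?V y)\<^sup>2) \<le> mode_bound B1 k \<mu>"
          unfolding bound using sum2 by (simp add: Dirichlet)
      qed auto
    qed
  qed
qed

subsection \<open>The eigensystem and summation over the modes\<close>

text \<open>The sine formula already gives 0 at n = 0, so only the integer cosine system keeps an
  exceptional first function.\<close>

lemma eigen_system_cases:
  assumes "eigen_system \<mu> X"
  obtains "\<mu> = (\<lambda>n. real n * pi)" "X = (\<lambda>n x. sqrt 2 * sin (\<mu> n * x))"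
  | "\<mu> = (\<lambda>n. real n * pi)" "X = (\<lambda>n x. if n = 0 then 1 else sqrt 2 * cos (\<mu> n * x))"
  | "\<mu> = (\<lambda>n. (real n + 1 / 2) * pi)" "X = (\<lambda>n x. sqrt 2 * sin (\<mu> n * x))"
  | "\<mu> = (\<lambda>n. (real n + 1 / 2) * pi)" "X = (\<lambda>n x. sqrt 2 * cos (\<mu> n * x))"
proof -
  have "(\<lambda>n x. if n = 0 then 0 else sqrt 2 * sin (real n * pi * x)) = (\<lambda>n x. sqrt 2 * sin (real n * pi * x))"
    by (auto simp: fun_eq_iff)
  with assms that show ?thesis
    unfolding eigen_system_def by auto
qed

text \<open>The four systems are reduced to common properties, so that orthogonality has one proof.
  The products at the end points vanish for all m and n, so integration by parts leaves no boundary
  term. The identity for X'^2 + \<mu>^2 X^2 encodes the factor sqrt 2; it is void for \<mu> n = 0,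
  which the last clause covers.\<close>

lemma eigen_system_derivative:
  assumes "eigen_system \<mu> X"
  obtains X' where "\<And>n x. (X n has_real_derivative X' n x) (at x)"
    "\<And>n x. (X' n has_real_derivative - (\<mu> n)\<^sup>2 * X n x) (at x)"
    "\<And>m n. X m 0 * X' n 0 = 0" "\<And>m n. X m 1 * X' n 1 = 0"
    "\<And>n x. (X' n x)\<^sup>2 + (\<mu> n)\<^sup>2 * (X n x)\<^sup>2 = 2 * (\<mu> n)\<^sup>2"
    "\<And>n x. \<mu> n = 0 \<Longrightarrow> (X n x)\<^sup>2 \<le> 1"
proof -
  have half: "cos ((real n + 1 / 2) * pi) = 0" for n
    by (simp add: distrib_right cos_add)
  note result = that
  have sin_case: thesis
    if X: "X = (\<lambda>n x. sqrt 2 * sin (\<mu> n * x))"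
      and bd: "\<And>m n. sin (\<mu> m) * (\<mu> n * cos (\<mu> n)) = 0"
  proof (rule result[of "\<lambda>n x. sqrt 2 * (\<mu> n * cos (\<mu> n * x))"])
    show "(X n has_real_derivative sqrt 2 * (\<mu> n * cos (\<mu> n * x))) (at x)" for n x
      unfolding X by (auto intro!: derivative_eq_intros)
    show "((\<lambda>x. sqrt 2 * (\<mu> n * cos (\<mu> n * x))) has_real_derivative - (\<mu> n)\<^sup>2 * X n x) (at x)" for n x
      unfolding X by (auto intro!: derivative_eq_intros simp: power2_eq_square)
    show "X m 0 * (sqrt 2 * (\<mu> n * cos (\<mu> n * 0))) = 0" for m n
      by (simp add: X)
    show "X m 1 * (sqrt 2 * (\<mu> n * cos (\<mu> n * 1))) = 0" for m n
      using bd[of m n] by (simp add: X)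
    show "(sqrt 2 * (\<mu> n * cos (\<mu> n * x)))\<^sup>2 + (\<mu> n)\<^sup>2 * (X n x)\<^sup>2 = 2 * (\<mu> n)\<^sup>2" for n x
      by (simp add: X power_mult_distrib sin_squared_eq algebra_simps)
  qed (simp add: X)
  have cos_case: thesis
    if X: "X = (\<lambda>n x. a n * cos (\<mu> n * x))" and a: "\<And>n. \<mu> n \<noteq> 0 \<Longrightarrow> a n = sqrt 2" "\<And>n. \<mu> n = 0 \<Longrightarrow> a n = 1"
      and bd: "\<And>m n. cos (\<mu> m) * (\<mu> n * sin (\<mu> n)) = 0" for a
  proof (rule result[of "\<lambda>n x. - (a n * (\<mu> n * sin (\<mu> n * x)))"])
    show "(X n has_real_derivative - (a n * (\<mu> n * sin (\<mu> n * x)))) (at x)" for n x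
      unfolding X by (auto intro!: derivative_eq_intros)
    show "((\<lambda>x. - (a n * (\<mu> n * sin (\<mu> n * x)))) has_real_derivative - (\<mu> n)\<^sup>2 * X n x) (at x)" for n x
      unfolding X by (auto intro!: derivative_eq_intros simp: power2_eq_square)
    show "X m 0 * - (a n * (\<mu> n * sin (\<mu> n * 0))) = 0" for m n
      by simp
    show "X m 1 * - (a n * (\<mu> n * sin (\<mu> n * 1))) = 0" for m n
      using bd[of m n] by (auto simp: X)
    show "(- (a n * (\<mu> n * sin (\<mu> n * x))))\<^sup>2 + (\<mu> n)\<^sup>2 * (X n x)\<^sup>2 = 2 * (\<mu> n)\<^sup>2" for n x
    proof (cases "\<mu> n = 0")
      case False
      then show ?thesis
        by (simp add: X a power_mult_distrib sin_squared_eq algebra_simps)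
    qed simp
    show "(X n x)\<^sup>2 \<le> 1" if "\<mu> n = 0" for n x
      using a[of n] that by (simp add: X)
  qed
  show thesis
    using assms
  proof (cases rule: eigen_system_cases)
    case 1
    then show ?thesis by (intro sin_case) auto
  next
    case 2
    show ?thesis
    proof (rule cos_case)
      show "X = (\<lambda>n x. (if n = 0 then 1 else sqrt 2) * cos (\<mu> n * x))"
        unfolding 2(2) by (auto simp: fun_eq_iff 2(1))
    qed (auto simp: 2(1))
  next
    case 3
    then show ?thesis using half by (intro sin_case) auto
  next
    case 4
    show ?thesis
    proof (rule cos_case[OF 4(2)])
      have "\<mu> n \<noteq> 0" for n by (simp add: 4(1) add_eq_0_iff)
      then show "\<And>n. \<mu> n = 0 \<Longrightarrow> sqrt 2 = 1" by blast
      show "cos (\<mu> m) * (\<mu> n * sin (\<mu> n)) = 0" for m n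
        using half by (simp add: 4(1))
    qed auto
  qed
qed

lemma eigen_system_inj:
  assumes "eigen_system \<mu> X" "m \<noteq> n"
  shows "(\<mu> m)\<^sup>2 \<noteq> (\<mu> n)\<^sup>2"
  using assms by (auto simp: eigen_system_def power2_eq_iff_nonneg)

text \<open>Integration by parts gives \<integral> X' m X' n = (\<mu> n)^2 \<integral> X m X n.
  Exchanging m and n yields both orthogonalities, because the (\<mu> n)^2 are distinct. For m = n
  the integrated identity for X'^2 + \<mu>^2 X^2 fixes the norm, so no trigonometric integral is
  computed.\<close>

lemma eigen_system_orthonormal:
  assumes X: "eigen_system \<mu> X"
  obtains X' where "\<And>n x. (X n has_real_derivative X' n x) (at x)" "\<And>n. continuous_on UNIV (X' n)"
    "\<And>m n. m \<noteq> n \<Longrightarrow> integral {0..1} (\<lambda>x. X m x * X n x) = 0"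
    "\<And>m n. m \<noteq> n \<Longrightarrow> integral {0..1} (\<lambda>x. X' m x * X' n x) = 0"
    "\<And>n. integral {0..1} (\<lambda>x. (X n x)\<^sup>2) \<le> 1"
    "\<And>n. integral {0..1} (\<lambda>x. (X' n x)\<^sup>2) \<le> (\<mu> n)\<^sup>2"
proof -
  obtain X' where dX: "\<And>n x. (X n has_real_derivative X' n x) (at x)"
    and dX': "\<And>n x. (X' n has_real_derivative - (\<mu> n)\<^sup>2 * X n x) (at x)"
    and bd: "\<And>m n. X m 0 * X' n 0 = 0" "\<And>m n. X m 1 * X' n 1 = 0"
    and const: "\<And>n x. (X' n x)\<^sup>2 + (\<mu> n)\<^sup>2 * (X n x)\<^sup>2 = 2 * (\<mu> n)\<^sup>2"
    and le: "\<And>n x. \<mu> n = 0 \<Longrightarrow> (X n x)\<^sup>2 \<le> 1"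
    using eigen_system_derivative[OF X] by blast
  have c: "continuous_on A (X n)" "continuous_on A (X' n)" for A n
    using dX dX' by (meson DERIV_isCont continuous_at_imp_continuous_on)+
  have int: "(\<lambda>x. X m x * X n x) integrable_on {0..1}" "(\<lambda>x. X' m x * X' n x) integrable_on {0..1}" for m n
    by (intro integrable_continuous_interval continuous_intros c)+
  have parts: "integral {0..1} (\<lambda>x. X' m x * X' n x) = (\<mu> n)\<^sup>2 * integral {0..1} (\<lambda>x. X m x * X n x)" for m n
  proof -
    have "((\<lambda>x. X m x * X' n x) has_vector_derivative (X' m x * X' n x - (\<mu> n)\<^sup>2 * (X m x * X n x))) (at x)" for x
      unfolding has_real_derivative_iff_has_vector_derivative[symmetric]
      by (rule DERIV_cong[OF DERIV_mult[OF dX dX']]) (simp add: algebra_simps)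
    then have "integral {0..1} (\<lambda>x. X' m x * X' n x - (\<mu> n)\<^sup>2 * (X m x * X n x)) = X m 1 * X' n 1 - X m 0 * X' n 0"
      by (rule integral_derivative_unit_interval)
    then show ?thesis
      using int by (simp add: bd integral_diff integrable_on_mult_right)
  qed
  have orth: "integral {0..1} (\<lambda>x. X m x * X n x) = 0" if "m \<noteq> n" for m n
  proof -
    have "(\<mu> n)\<^sup>2 * integral {0..1} (\<lambda>x. X m x * X n x) = (\<mu> m)\<^sup>2 * integral {0..1} (\<lambda>x. X m x * X n x)"
      using parts[of m n] parts[of n m] by (simp add: mult.commute)
    then show ?thesis
      using eigen_system_inj[OF X that] by auto
  qed
  have sq: "integral {0..1} (\<lambda>x. (X' n x)\<^sup>2) = (\<mu> n)\<^sup>2 * integral {0..1} (\<lambda>x. (X n x)\<^sup>2)" for n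
    using parts[of n n] by (simp add: power2_eq_square)
  have norm: "integral {0..1} (\<lambda>x. (X n x)\<^sup>2) \<le> 1" for n
  proof (cases "\<mu> n = 0")
    case True
    then show ?thesis
      by (intro integral_unit_interval_le continuous_intros c le)
  next
    case False
    have "integral {0..1} (\<lambda>x. (X' n x)\<^sup>2 + (\<mu> n)\<^sup>2 * (X n x)\<^sup>2) = 2 * (\<mu> n)\<^sup>2"
      unfolding const by simp
    moreover have "integral {0..1} (\<lambda>x. (X' n x)\<^sup>2 + (\<mu> n)\<^sup>2 * (X n x)\<^sup>2) =
        integral {0..1} (\<lambda>x. (X' n x)\<^sup>2) + (\<mu> n)\<^sup>2 * integral {0..1} (\<lambda>x. (X n x)\<^sup>2)"
      using int[of n n] by (simp add: integral_add integrable_on_mult_right power2_eq_square)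
    ultimately show ?thesis
      using False sq[of n] by simp
  qed
  have "integral {0..1} (\<lambda>x. (X' n x)\<^sup>2) \<le> (\<mu> n)\<^sup>2" for n
    unfolding sq using mult_left_mono[OF norm[of n], of "(\<mu> n)\<^sup>2"] by simp
  then show thesis
    using orth norm dX c(2) by (intro that[of X']) (auto simp: parts)
qed

section \<open>Summation of the series\<close>

lemma L2_sums_cong:
  assumes "\<And>n z. z \<in> S \<Longrightarrow> f n z = h n z"
  shows "L2_sums S f u \<longleftrightarrow> L2_sums S h u"
proof -
  have "L2_on S (f n) \<longleftrightarrow> L2_on S (h n)" for n
    using assms by (intro L2_on_cong) auto
  moreover have "L2_norm S (\<lambda>z. u z - (\<Sum>n<N. f n z)) = L2_norm S (\<lambda>z. u z - (\<Sum>n<N. h n z))" for N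
    using assms by (intro L2_norm_cong) auto
  ultimately show ?thesis
    by (simp add: L2_sums_def)
qed

text \<open>The squared coefficients times A + B \<mu> n majorize the energies of the modes.
  Bessel's inequality sums the A part to the norm of g, while the B part is left as a series, to be
  recognized as the squared norm in Z^(1/2).\<close>

lemma series_estimate:
  fixes g :: "real \<Rightarrow> complex"
  assumes k: "k > 0" and X: "eigen_system \<mu> X" and g: "L2_on Gamma1 g"
    and AB: "A \<ge> 0" "\<And>n. \<mu> n \<ge> 0" "B \<ge> 0"
    and B: "summable (\<lambda>n. B * ((cmod (ghat X g n))\<^sup>2 * \<mu> n))"
    and V: "\<And>n y. (V n has_real_derivative V' n y) (at y)" "\<And>n. continuous_on UNIV (V' n)"
    and YV: "\<And>n y. y \<in> {0..1} \<Longrightarrow> Y n y = V n y"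
    and E: "\<And>n. (\<mu> n)\<^sup>2 * integral {0..1} (\<lambda>y. (V n y)\<^sup>2) + integral {0..1} (\<lambda>y. (V' n y)\<^sup>2) \<le> A + B * \<mu> n"
    and kE: "\<And>n. k\<^sup>2 * integral {0..1} (\<lambda>y. (V n y)\<^sup>2) \<le> A + B * \<mu> n"
  shows "(\<exists>u. L2_sums Omega (u_term X Y g) u) \<and>
    (\<forall>u. L2_sums Omega (u_term X Y g) u \<longrightarrow> (\<exists>G. weak_gradient Omega u G \<and>
      L2_norm Omega G + k * L2_norm Omega u
        \<le> 2 * sqrt (A * (L2_norm Gamma1 g)\<^sup>2 + (\<Sum>n. B * ((cmod (ghat X g n))\<^sup>2 * \<mu> n)))))"
proof -
  let ?a = "\<lambda>n. (cmod (ghat X g n))\<^sup>2" and ?N = "(L2_norm Gamma1 g)\<^sup>2"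
  obtain X' where X': "\<And>n x. (X n has_real_derivative X' n x) (at x)" "\<And>n. continuous_on UNIV (X' n)"
    "\<And>m n. m \<noteq> n \<Longrightarrow> integral {0..1} (\<lambda>x. X m x * X n x) = 0"
    "\<And>m n. m \<noteq> n \<Longrightarrow> integral {0..1} (\<lambda>x. X' m x * X' n x) = 0"
    "\<And>n. integral {0..1} (\<lambda>x. (X n x)\<^sup>2) \<le> 1"
    "\<And>n. integral {0..1} (\<lambda>x. (X' n x)\<^sup>2) \<le> (\<mu> n)\<^sup>2"
    using eigen_system_orthonormal[OF X] by blast
  have cX: "continuous_on A (X n)" for A n
    using X'(1) by (meson DERIV_isCont continuous_at_imp_continuous_on)
  have G1: "(LINT x|lebesgue_on Gamma1. f x) = integral {0..1} f" if "continuous_on {0..1} f" for f :: "real \<Rightarrow> real"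
    unfolding Gamma1_eq_box using that by (subst integral_box_continuous) auto
  have bessel: "summable ?a" "(\<Sum>n. ?a n) \<le> ?N"
  proof -
    have L: "L2_on Gamma1 (X n)" for n
      unfolding Gamma1_eq_box by (intro L2_on_box_continuous cX)
    have o: "(LINT x|lebesgue_on Gamma1. X m x * X n x) = 0" if "m \<noteq> n" for m n
      using X'(3)[OF that] by (subst G1) (auto intro!: continuous_intros cX)
    have n: "(LINT x|lebesgue_on Gamma1. (X n x)\<^sup>2) \<le> 1" for n
      using X'(5) by (subst G1) (auto intro!: continuous_intros cX)
    show "summable ?a" "(\<Sum>n. ?a n) \<le> ?N"
      using Bessel_inequality[OF g L o n] by auto
  qed
  define c where "c n = A * ?a n + B * (?a n * \<mu> n)" for n
  have c: "summable c"
    unfolding c_def by (rule summable_add[OF summable_mult[OF bessel(1)] B])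
  have c_le: "suminf c \<le> A * ?N + (\<Sum>n. B * (?a n * \<mu> n))"
    unfolding c_def suminf_add[OF summable_mult[OF bessel(1)] B, symmetric] suminf_mult[OF bessel(1)]
    using bessel(2) AB(1) by (intro add_right_mono mult_left_mono)
  have c_eq: "c n = ?a n * (A + B * \<mu> n)" for n
    by (simp add: c_def algebra_simps)
  have E': "?a n * ((\<mu> n)\<^sup>2 * integral {0..1} (\<lambda>y. (V n y)\<^sup>2) + integral {0..1} (\<lambda>y. (V' n y)\<^sup>2)) \<le> c n" for n
    unfolding c_eq by (intro mult_left_mono E) auto
  \<comment> \<open>Division by k^2 gives \<open>u\<close> the majorant c / k^2, so that k
    \<open>u\<close> obeys the same bound as the gradient.\<close>
  have kE': "?a n * integral {0..1} (\<lambda>y. (V n y)\<^sup>2) \<le> c n / k\<^sup>2" for n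
  proof -
    have "integral {0..1} (\<lambda>y. (V n y)\<^sup>2) \<le> (A + B * \<mu> n) / k\<^sup>2"
      using kE[of n] k by (simp add: field_simps)
    from mult_left_mono[OF this, of "?a n"] show ?thesis
      by (simp add: c_eq)
  qed
  let ?f = "\<lambda>n z. ghat X g n * of_real (X n (fst z)) * of_real (V n (snd z))"
  have cong: "L2_sums Omega (u_term X Y g) u \<longleftrightarrow> L2_sums Omega ?f u" for u
    by (rule L2_sums_cong) (auto simp: u_term_def Omega_def YV)
  note S = separated_series[where a = "ghat X g", OF X'(1,2) V X'(3-6) E' kE' c summable_divide[OF c]]
  show ?thesis
    unfolding cong
  proof (intro conjI allI impI S(1))
    fix u assume "L2_sums Omega ?f u"
    then obtain G where G: "weak_gradient Omega u G" "L2_norm Omega G \<le> sqrt (suminf c)"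
      "L2_norm Omega u \<le> sqrt (\<Sum>n. c n / k\<^sup>2)"
      using S(2) by blast
    have "k * L2_norm Omega u \<le> k * sqrt (\<Sum>n. c n / k\<^sup>2)"
      using G(3) k by simp
    also have "\<dots> = sqrt (suminf c)"
      using k by (simp add: suminf_divide[OF c] real_sqrt_divide)
    finally have "L2_norm Omega G + k * L2_norm Omega u \<le> 2 * sqrt (suminf c)"
      using G(2) by simp
    also have "\<dots> \<le> 2 * sqrt (A * ?N + (\<Sum>n. B * (?a n * \<mu> n)))"
      using c_le by simp
    finally show "\<exists>G. weak_gradient Omega u G \<and> L2_norm Omega G + k * L2_norm Omega u
        \<le> 2 * sqrt (A * ?N + (\<Sum>n. B * (?a n * \<mu> n)))"
      using G(1) by blast
  qed
qed

theorem theorem2p9: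
  fixes B1 B3 :: bc and k :: real
    and X Y :: "nat \<Rightarrow> real \<Rightarrow> real" and g1 :: "real \<Rightarrow> complex"
  assumes "k > 0"
    and "eigen_system (mu B1 B3 k) X"
    and "\<And>n. is_Y_solution B1 B3 k (mu B1 B3 k n) (Y n)"
  shows "(B1 = Neumann \<and> L2_on Gamma1 g1 \<longrightarrow>
            (\<exists>u. L2_sums Omega (u_term X Y g1) u) \<and>
            (\<forall>u. L2_sums Omega (u_term X Y g1) u \<longrightarrow>
               (\<exists>G. weak_gradient Omega u G \<and>
                  L2_norm Omega G + k * L2_norm Omega u
                    \<le> 2 * sqrt 717 * max k 1 * L2_norm Gamma1 g1)))
       \<and> (B1 = Dirichlet \<and> Z_space (mu B1 B3 k) X (1/2) g1 \<longrightarrow>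
            (\<exists>u. L2_sums Omega (u_term X Y g1) u) \<and>
            (\<forall>u. L2_sums Omega (u_term X Y g1) u \<longrightarrow>
               (\<exists>G. weak_gradient Omega u G \<and>
                  L2_norm Omega G + k * L2_norm Omega u
                    \<le> 2 * sqrt 43 * (max (k\<^sup>2) 1 * L2_norm Gamma1 g1
                          + max (k powr (1/2)) 1 * Z_norm (mu B1 B3 k) X (1/2) g1))))"
proof -
  let ?\<mu> = "mu B1 B3 k" and ?N = "L2_norm Gamma1 g1"
  \<comment> \<open>Bundled into one predicate so that V and V' can be chosen for all n at
    once.\<close>
  define P where "P n V V' \<longleftrightarrow> (\<forall>y\<in>{0..1}. Y n y = V y) \<and> (\<forall>y. (V has_real_derivative V' y) (at y)) \<and>
      continuous_on UNIV V' \<and>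
      (?\<mu> n)\<^sup>2 * integral {0..1} (\<lambda>y. (V y)\<^sup>2) + integral {0..1} (\<lambda>y. (V' y)\<^sup>2) \<le> mode_bound B1 k (?\<mu> n) \<and>
      k\<^sup>2 * integral {0..1} (\<lambda>y. (V y)\<^sup>2) \<le> mode_bound B1 k (?\<mu> n)" for n V V'
  have "\<exists>V V'. P n V V'" for n
  proof (rule mode_estimate[OF assms(1) mu_nonneg assms(3) mu_nonresonance, of n])
    fix V V'
    assume "\<And>y. y \<in> {0..1} \<Longrightarrow> Y n y = V y" "\<And>y. (V has_real_derivative V' y) (at y)" "continuous_on UNIV V'"
      "(?\<mu> n)\<^sup>2 * integral {0..1} (\<lambda>y. (V y)\<^sup>2) + integral {0..1} (\<lambda>y. (V' y)\<^sup>2) \<le> mode_bound B1 k (?\<mu> n)"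
      "k\<^sup>2 * integral {0..1} (\<lambda>y. (V y)\<^sup>2) \<le> mode_bound B1 k (?\<mu> n)"
    then have "P n V V'" unfolding P_def by blast
    then show ?thesis by blast
  qed
  then obtain V V' where "\<And>n. P n (V n) (V' n)" by metis
  then have V: "\<And>n y. y \<in> {0..1} \<Longrightarrow> Y n y = V n y"
    "\<And>n y. (V n has_real_derivative V' n y) (at y)" "\<And>n. continuous_on UNIV (V' n)"
    "\<And>n. (?\<mu> n)\<^sup>2 * integral {0..1} (\<lambda>y. (V n y)\<^sup>2) + integral {0..1} (\<lambda>y. (V' n y)\<^sup>2) \<le> mode_bound B1 k (?\<mu> n)"
    "\<And>n. k\<^sup>2 * integral {0..1} (\<lambda>y. (V n y)\<^sup>2) \<le> mode_bound B1 k (?\<mu> n)"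
    unfolding P_def by blast+
  have est: "(\<exists>u. L2_sums Omega (u_term X Y g1) u) \<and>
    (\<forall>u. L2_sums Omega (u_term X Y g1) u \<longrightarrow> (\<exists>G. weak_gradient Omega u G \<and>
      L2_norm Omega G + k * L2_norm Omega u \<le> C))"
    if "L2_on Gamma1 g1" "A \<ge> 0" "B \<ge> 0" "\<And>n. mode_bound B1 k (?\<mu> n) = A + B * ?\<mu> n"
      "summable (\<lambda>n. B * ((cmod (ghat X g1 n))\<^sup>2 * ?\<mu> n))"
      "2 * sqrt (A * ?N\<^sup>2 + (\<Sum>n. B * ((cmod (ghat X g1 n))\<^sup>2 * ?\<mu> n))) \<le> C" for A B C
    using series_estimate[OF assms(1,2) that(1,2) mu_nonneg that(3,5) V(2,3,1) V(4,5)[unfolded that(4)]] that(6)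
    by (meson order_trans)
  have "(\<exists>u. L2_sums Omega (u_term X Y g1) u) \<and>
    (\<forall>u. L2_sums Omega (u_term X Y g1) u \<longrightarrow> (\<exists>G. weak_gradient Omega u G \<and>
      L2_norm Omega G + k * L2_norm Omega u \<le> 2 * sqrt 717 * max k 1 * ?N))"
    if "B1 = Neumann" "L2_on Gamma1 g1"
  \<comment> \<open>Under a Neumann condition the bound does not grow with \<mu>, so the weighted
    series has coefficient 0 and Bessel's inequality alone decides.\<close>
  proof (rule est[where B = 0 and A = "717 * (max k 1)\<^sup>2", OF that(2)])
    show "2 * sqrt (717 * (max k 1)\<^sup>2 * ?N\<^sup>2 + (\<Sum>n. 0 * ((cmod (ghat X g1 n))\<^sup>2 * ?\<mu> n))) \<le> 2 * sqrt 717 * max k 1 * ?N"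
      using L2_norm_nonneg[of Gamma1 g1] by (simp add: real_sqrt_mult)
  qed (auto simp: mode_bound_def that)
  moreover have "(\<exists>u. L2_sums Omega (u_term X Y g1) u) \<and>
    (\<forall>u. L2_sums Omega (u_term X Y g1) u \<longrightarrow> (\<exists>G. weak_gradient Omega u G \<and>
      L2_norm Omega G + k * L2_norm Omega u \<le> 2 * sqrt 43 * (max (k\<^sup>2) 1 * ?N
                          + max (k powr (1/2)) 1 * Z_norm ?\<mu> X (1/2) g1)))"
    if B1: "B1 = Dirichlet" and Z: "Z_space ?\<mu> X (1/2) g1"
  proof -
    \<comment> \<open>The exponent is 1 for s = 1/2, and \<open>0 powr 1 = 0\<close> makes this hold
      also where \<mu> vanishes.\<close>
    have w: "Z_weight (1/2) (?\<mu> n) = ?\<mu> n" for n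
      using mu_nonneg by (simp add: Z_weight_def)
    let ?a = "\<lambda>n. (cmod (ghat X g1 n))\<^sup>2 * ?\<mu> n"
    have g: "L2_on Gamma1 g1" and s: "summable ?a"
      using Z by (auto simp: Z_space_def w)
    have Zn: "(Z_norm ?\<mu> X (1/2) g1)\<^sup>2 = suminf ?a" "Z_norm ?\<mu> X (1/2) g1 \<ge> 0"
      unfolding Z_norm_def w using s mu_nonneg by (auto intro!: suminf_nonneg)
    \<comment> \<open>This makes the coefficient max k 1 of the weighted sum a perfect square, the
      one in front of the Z^(1/2) norm.\<close>
    have m: "(max (k powr (1/2)) 1)\<^sup>2 = max k 1"
      using assms(1) by (auto simp: max_def powr_half_sqrt)
    show ?thesis
    proof (rule est[where B = "43 * max k 1" and A = "43 * (max (k\<^sup>2) 1)\<^sup>2", OF g])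
      let ?p = "max (k\<^sup>2) 1 * ?N" and ?q = "max (k powr (1/2)) 1 * Z_norm ?\<mu> X (1/2) g1"
      have pq: "?p \<ge> 0" "?q \<ge> 0"
        using L2_norm_nonneg[of Gamma1 g1] Zn(2) by auto
      have "43 * (max (k\<^sup>2) 1)\<^sup>2 * ?N\<^sup>2 + (\<Sum>n. 43 * max k 1 * ?a n) = 43 * (?p\<^sup>2 + ?q\<^sup>2)"
        unfolding suminf_mult[OF s] by (simp add: power_mult_distrib m Zn(1) algebra_simps)
      also have "\<dots> \<le> 43 * (?p + ?q)\<^sup>2"
      proof -
        \<comment> \<open>The root of the sum of squares becomes the sum of the two norms, as the
          mixed term is nonnegative.\<close>
        have "?p\<^sup>2 + ?q\<^sup>2 \<le> (?p + ?q)\<^sup>2"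
          unfolding power2_sum using mult_nonneg_nonneg[OF pq] by linarith
        then show ?thesis by simp
      qed
      finally have "sqrt (43 * (max (k\<^sup>2) 1)\<^sup>2 * ?N\<^sup>2 + (\<Sum>n. 43 * max k 1 * ?a n)) \<le> sqrt (43 * (?p + ?q)\<^sup>2)"
        by (rule real_sqrt_le_mono)
      also have "\<dots> = sqrt 43 * (?p + ?q)"
        using pq by (simp add: real_sqrt_mult)
      finally show "2 * sqrt (43 * (max (k\<^sup>2) 1)\<^sup>2 * ?N\<^sup>2 + (\<Sum>n. 43 * max k 1 * ?a n)) \<le> 2 * sqrt 43 * (?p + ?q)"
        by simp
      show "summable (\<lambda>n. 43 * max k 1 * ?a n)"
        using s by (rule summable_mult)
    qed (auto simp: mode_bound_def B1)
  qed
  ultimately show ?thesis by blast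
qed

end
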